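(* For every $\epsilon > 0$ there exists a Radon probability measure $\mu$ on $\mathbb{R}^2$ supported on $[0,1]^2$ with the following properties: (1) $J_{1,\mu}(x) \leq \epsilon$ for all $x \in \operatorname{spt}\mu$, where $$J_{1,\mu}(x) := \sum_{Q \in \mathcal{D},\ \ell(Q) \leq 1} \beta_{2,\mu}(3Q)^2\, \frac{\ell(Q)}{\mu(Q)}\, 1_Q(x);$$ (2) $\Theta^1_*(\mu,x) := \liminf_{r \to 0} \frac{\mu(B(x,r))}{2r} = 0$ for $\mu$-a.e. $x$. In particular, $\mu$ is purely $1$-unrectifiable, i.e. $\mu(f(\mathbb{R})) = 0$ for every Lipschitz map $f\colon \mathbb{R} \to \mathbb{R}^2$.
   Context: $\mathcal{D}$ is the standard dyadic grid in $\mathbb{R}^2$: all half-open squares $[k2^{-j},(k+1)2^{-j}) \times [l2^{-j},(l+1)2^{-j})$ with $j,k,l \in \mathbb{Z}$. $\ell(Q)$ is the side-length of $Q$, and $3Q$ is the square with the same centre as $Q$ dilated by a factor of three, i.e. the union of $Q$ with its eight dyadic neighbours of the same side-length. $B(x,r)$ is the open ball of radius $r$ centred at $x$. $\operatorname{spt}\mu$ is the (closed) support of $\mu$. For a Radon measure $\mu$ on $\mathbb{R}^2$ and a square $Q \subset \mathbb{R}^2$ with $\mu(Q) > 0$, $$\beta_{2,\mu}(Q) = \inf_L \left[ \frac{1}{\mu(Q)} \int_Q \left( \frac{d(y,L)}{\operatorname{diam}(Q)} \right)^2 d\mu(y) \right]^{1/2},$$ where the infimum is over all affine lines $L \subset \mathbb{R}^2$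 and $d(y,L)$ is the Euclidean distance from $y$ to $L$. *)

theory Defs
  imports "HOL-Analysis.Analysis" "HOL-Probability.Probability"
begin

definition radon_measure :: "'a::t2_space measure \<Rightarrow> bool" where
  "radon_measure M \<longleftrightarrow>
     sets M = sets borel \<and>
     (\<forall>K. compact K \<longrightarrow> emeasure M K < \<infinity>) \<and>
     (\<forall>U. open U \<longrightarrow> emeasure M U = (SUP K\<in>{K. compact K \<and> K \<subseteq> U}. emeasure M K)) \<and>
     (\<forall>A\<in>sets borel. emeasure M A = (INF U\<in>{U. open U \<and> A \<subseteq> U}. emeasure M U))"

definition spt :: "'a::topological_space measure \<Rightarrow> 'a set" where
  "spt M = - \<Union>{U. open U \<and> emeasure M U = 0}"

definition half_open_square :: "real^2 \<Rightarrow> real \<Rightarrow> (real^2) set" where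
  "half_open_square a s = {x. \<forall>i. a $ i \<le> x $ i \<and> x $ i < a $ i + s}"

definition dyadic_squares :: "(real^2) set set" where
  "dyadic_squares =
     {half_open_square (vector [of_int k * 2 powi (-j), of_int l * 2 powi (-j)]) (2 powi (-j))
       | j k l :: int. True}"

definition side_length :: "(real^2) set \<Rightarrow> real" where
  "side_length Q = (THE s. s > 0 \<and> (\<exists>a. Q = half_open_square a s))"

definition centre :: "(real^2) set \<Rightarrow> real^2" where
  "centre Q = (THE c. \<exists>a s. s > 0 \<and> Q = half_open_square a s \<and> c = (\<chi> i. a $ i + s / 2))"

definition triple :: "(real^2) set \<Rightarrow> (real^2) set" where
  "triple Q = (\<lambda>x. centre Q + 3 *\<^sub>R (x - centre Q)) ` Q"

lemma half_open_square_inject: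
  assumes s: "s > 0" and t: "t > 0" and eq: "half_open_square a s = half_open_square b t"
  shows "a = b" "s = t"
proof -
  have "a \<in> half_open_square a s" "b \<in> half_open_square b t"
    using s t by (auto simp: half_open_square_def)
  then have "a \<in> half_open_square b t" "b \<in> half_open_square a s"
    using eq by auto
  then show ab: "a = b"
    by (auto simp: half_open_square_def vec_eq_iff intro: order_antisym)
  have le: "u \<le> v" if "u > 0" "v > 0" "half_open_square a u = half_open_square a v" for u v
  proof (rule ccontr)
    assume "\<not> u \<le> v"
    then have "(\<chi> i. a $ i + v) \<in> half_open_square a u"
      using that(1,2) by (simp add: half_open_square_def)
    moreover have "(\<chi> i. a $ i + v) \<notin> half_open_square a v"
      by (auto simp: half_open_square_def)
    ultimately show False using that by auto
  qed
  show "s = t"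
    using le[of s t] le[of t s] s t eq ab by auto
qed

lemma side_length_half_open_square [simp]:
  "s > 0 \<Longrightarrow> side_length (half_open_square a s) = s"
  unfolding side_length_def by (rule the_equality) (auto dest: half_open_square_inject)

lemma centre_half_open_square [simp]:
  assumes "s > 0"
  shows "centre (half_open_square a s) = (\<chi> i. a $ i + s / 2)"
  unfolding centre_def
proof (rule the_equality)
  fix c
  assume "\<exists>b t. t > 0 \<and> half_open_square a s = half_open_square b t \<and> c = (\<chi> i. b $ i + t / 2)"
  then show "c = (\<chi> i. a $ i + s / 2)"
    using half_open_square_inject[OF assms] by metis
qed (use assms in auto)

lemma triple_half_open_square:
  assumes s: "s > 0"
  shows "triple (half_open_square a s) = half_open_square (\<chi> i. a $ i - s) (3 * s)"
proof -
  let ?c = "\<chi> i. a $ i + s / 2"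
  have "x \<in> (\<lambda>x. ?c + 3 *\<^sub>R (x - ?c)) ` half_open_square a s"
    if x: "x \<in> half_open_square (\<chi> i. a $ i - s) (3 * s)" for x
  proof (rule image_eqI)
    show "x = ?c + 3 *\<^sub>R ((?c + (1/3) *\<^sub>R (x - ?c)) - ?c)"
      by (simp add: vec_eq_iff)
    have "a $ i \<le> a $ i + s / 2 + (x $ i - (a $ i + s / 2)) / 3 \<and>
          a $ i + s / 2 + (x $ i - (a $ i + s / 2)) / 3 < a $ i + s" for i
    proof -
      have "a $ i - s \<le> x $ i" "x $ i < a $ i - s + 3 * s"
        using x by (auto simp: half_open_square_def)
      then show ?thesis by (simp add: field_simps)
    qed
    then show "?c + (1/3) *\<^sub>R (x - ?c) \<in> half_open_square a s"
      by (simp add: half_open_square_def)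
  qed
  moreover have "?c + 3 *\<^sub>R (x - ?c) \<in> half_open_square (\<chi> i. a $ i - s) (3 * s)"
    if x: "x \<in> half_open_square a s" for x
  proof -
    have "a $ i - s \<le> a $ i + s / 2 + 3 * (x $ i - (a $ i + s / 2)) \<and>
          a $ i + s / 2 + 3 * (x $ i - (a $ i + s / 2)) < a $ i - s + 3 * s" for i
    proof -
      have "a $ i \<le> x $ i" "x $ i < a $ i + s"
        using x by (auto simp: half_open_square_def)
      then show ?thesis by (simp add: field_simps)
    qed
    then show ?thesis by (simp add: half_open_square_def)
  qed
  ultimately show ?thesis
    unfolding triple_def centre_half_open_square[OF s] by blast
qed

definition affine_lines :: "(real^2) set set" where
  "affine_lines = {L. affine L \<and> aff_dim L = 1}"

definition beta2 :: "(real^2) measure \<Rightarrow> (real^2) set \<Rightarrow> real" where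
  "beta2 M Q = (INF L\<in>affine_lines.
     sqrt (1 / measure M Q * (LINT y:Q|M. (infdist y L / diameter Q)\<^sup>2)))"

text \<open>
  The sum is taken in \<open>[0, \<infinity>]\<close>. In \<^typ>\<open>ennreal\<close>, \<open>a / 0 = \<infinity>\<close> for \<open>a > 0\<close> and
  \<open>0 * \<infinity> = 0\<close>, so a square \<open>Q \<ni> x\<close> with \<open>\<mu>(Q) = 0\<close> contributes \<open>\<infinity>\<close> unless
  \<open>\<beta>(3Q) = 0\<close>, and squares not containing \<open>x\<close> contribute \<open>0\<close>.
\<close>

definition jones1 :: "(real^2) measure \<Rightarrow> real^2 \<Rightarrow> ennreal" where
  "jones1 M x = (\<Sum>\<^sub>\<infinity>Q\<in>{Q \<in> dyadic_squares. side_length Q \<le> 1}.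
     ennreal ((beta2 M (triple Q))\<^sup>2) * (ennreal (side_length Q) / emeasure M Q) * indicator Q x)"

definition lower_density1 :: "(real^2) measure \<Rightarrow> real^2 \<Rightarrow> ennreal" where
  "lower_density1 M x = Liminf (at_right 0) (\<lambda>r. emeasure M (ball x r) / ennreal (2 * r))"

definition purely_1_unrectifiable :: "(real^2) measure \<Rightarrow> bool" where
  "purely_1_unrectifiable M \<longleftrightarrow>
     (\<forall>f :: real \<Rightarrow> real^2. (\<exists>C. C-lipschitz_on UNIV f) \<longrightarrow> emeasure M (range f) = 0)"

end

theory Submission imports Defs begin

text \<open>
  The measure is a homogeneous Cantor measure. A square with parameter \<open>b\<close>, of side \<open>r\<close> and
  mass \<open>2\<^sup>b\<^sup>+\<^sup>1 r\<close>, is replaced by tiny squares with parameter \<open>b + 1\<close> (the next generation) placed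
  along horizontal lines: half of its mass goes uniformly to the bottom edge, the centre row, which
  thus has linear density \<open>2\<^sup>b\<close>, and the other half goes to \<open>4\<^sup>b\<close> satellite rows at the lacunary
  heights \<open>4\<^sup>-\<^sup>i r\<close>, each of linear density only \<open>2\<^sup>-\<^sup>b\<close>. Concentrating mass on a line costs nothing
  in the Jones function, so the density can be raised again to \<open>2\<^sup>b\<^sup>+\<^sup>2\<close> inside the tiny squares.

  At the scale of its height, a satellite is seen next to the much heavier centre row, so that
  \<open>\<beta>\<^sup>2 \<lesssim> 2\<^sup>-\<^sup>b / 2\<^sup>b\<close>, and the weight \<open>\<ell>(Q)/\<mu>(Q) = 2\<^sup>b\<close> produces a contribution \<open>\<lesssim> 2\<^sup>-\<^sup>b\<close>. A square
  meeting the centre row contributes \<open>\<lesssim> 2\<^sup>-\<^sup>b / (2\<^sup>b 2\<^sup>b)\<close>, and there are about \<open>4\<^sup>b\<close> such scales.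
  At smaller scales only one row is visible. Hence the generation contributes \<open>\<lesssim> 2\<^sup>-\<^sup>b\<close>, which is
  summable. On the other hand a point lies in a satellite with probability one half in each
  generation, independently, so almost every point does so infinitely often and sees densities
  \<open>\<lesssim> 2\<^sup>-\<^sup>b\<close>.
\<close>

section \<open>Lower density and rectifiability\<close>

lemma radon_measure_finite_borel:
  fixes M :: "'a::{polish_space,heine_borel} measure"
  assumes M: "sets M = sets borel" and "finite_measure M"
  shows "radon_measure M"
proof -
  interpret finite_measure M by fact
  have "emeasure M (space M) \<noteq> \<infinity>"
    by (simp add: emeasure_finite)
  note regular = inner_regular[OF M this] outer_regular[OF M this]
  show ?thesis
    unfolding radon_measure_def
  proof (intro conjI allI impI ballI M)
    show "emeasure M K < \<infinity>" for K
      using emeasure_finite by (simp flip: less_top)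
    show "emeasure M U = (SUP K\<in>{K. compact K \<and> K \<subseteq> U}. emeasure M K)" if "open U" for U
      using regular(1)[of U] that by (simp add: conj_commute)
    show "emeasure M A = (INF U\<in>{U. open U \<and> A \<subseteq> U}. emeasure M U)" if "A \<in> sets borel" for A
      using regular(2)[OF that] by (simp add: conj_commute)
  qed
qed

lemma emeasure_UN_le_cmult_disjoint:
  assumes "countable I"
    and X: "\<And>i. i \<in> I \<Longrightarrow> X i \<in> sets M" and Y: "\<And>i. i \<in> I \<Longrightarrow> Y i \<in> sets N"
    and disj: "disjoint_family_on Y I"
    and le: "\<And>i. i \<in> I \<Longrightarrow> emeasure M (X i) \<le> c * emeasure N (Y i)"
  shows "emeasure M (\<Union>i\<in>I. X i) \<le> c * emeasure N (\<Union>i\<in>I. Y i)"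
proof -
  define X' where "X' n = (\<Union>i\<in>{i \<in> I. to_nat_on I i = n}. X i)" for n
  define Y' where "Y' n = (\<Union>i\<in>{i \<in> I. to_nat_on I i = n}. Y i)" for n
  have cases: "X' n = {} \<and> Y' n = {} \<or> (\<exists>i\<in>I. X' n = X i \<and> Y' n = Y i)" for n
  proof (cases "\<exists>i\<in>I. to_nat_on I i = n")
    case True
    then obtain i where "i \<in> I" "to_nat_on I i = n" by blast
    then have "{i \<in> I. to_nat_on I i = n} = {i}"
      using inj_on_to_nat_on[OF \<open>countable I\<close>] by (auto simp: inj_on_def)
    with \<open>i \<in> I\<close> show ?thesis by (auto simp: X'_def Y'_def)
  qed (auto simp: X'_def Y'_def)
  have X': "X' n \<in> sets M" and Y': "Y' n \<in> sets N"
    and le': "emeasure M (X' n) \<le> c * emeasure N (Y' n)" for n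
    using cases[of n] X Y le by auto
  have UN: "(\<Union>i\<in>I. X i) = (\<Union>n. X' n)" "(\<Union>i\<in>I. Y i) = (\<Union>n. Y' n)"
    by (auto simp: X'_def Y'_def)
  have "disjoint_family Y'"
    using disj by (fastforce simp: disjoint_family_on_def Y'_def)
  have "emeasure M (\<Union>n. X' n) \<le> (\<Sum>n. emeasure M (X' n))"
    using X' by (intro emeasure_subadditive_countably) auto
  also have "\<dots> \<le> (\<Sum>n. c * emeasure N (Y' n))"
    by (intro suminf_le le' summableI)
  also have "\<dots> = c * emeasure N (\<Union>n. Y' n)"
    using Y' \<open>disjoint_family Y'\<close> by (subst suminf_emeasure[symmetric]) auto
  finally show ?thesis by (simp add: UN)
qed

definition vanishing_lower_density :: "'a::metric_space measure \<Rightarrow> 'a \<Rightarrow> bool" where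
  "vanishing_lower_density M x \<longleftrightarrow>
     (\<forall>\<delta>>0. \<forall>d>0. \<exists>r>0. r < \<delta> \<and> emeasure M (ball x r) \<le> ennreal (d * r))"

lemma lower_density1_eq_0_iff: "lower_density1 M x = 0 \<longleftrightarrow> vanishing_lower_density M x"
proof
  assume "lower_density1 M x = 0"
  show "vanishing_lower_density M x"
    unfolding vanishing_lower_density_def
  proof (intro allI impI, rule ccontr)
    fix \<delta> d :: real
    assume "0 < \<delta>" "0 < d"
      and no_light_ball: "\<not> (\<exists>r>0. r < \<delta> \<and> emeasure M (ball x r) \<le> ennreal (d * r))"
    have "ennreal (d / 2) \<le> emeasure M (ball x r) / ennreal (2 * r)" if "0 < r" "r < \<delta>" for r
    proof -
      have "ennreal (d / 2) = ennreal (d * r) / ennreal (2 * r)"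
        using \<open>0 < r\<close> \<open>0 < d\<close> by (simp add: divide_ennreal)
      also have "\<dots> \<le> emeasure M (ball x r) / ennreal (2 * r)"
        using no_light_ball that by (intro divide_right_mono_ennreal) (meson nle_le)
      finally show ?thesis .
    qed
    then have "ennreal (d / 2) \<le> lower_density1 M x"
      unfolding lower_density1_def using \<open>0 < \<delta>\<close>
      by (intro Liminf_bounded) (auto simp: eventually_at_right_field)
    with \<open>lower_density1 M x = 0\<close> \<open>0 < d\<close> show False
      by (simp add: ennreal_eq_0_iff)
  qed
next
  assume light: "vanishing_lower_density M x"
  have "lower_density1 M x \<le> 0 + ennreal d" if "0 < d" for d
  proof (rule ccontr)
    assume "\<not> lower_density1 M x \<le> 0 + ennreal d"
    then have "\<forall>\<^sub>F r in at_right 0. ennreal d < emeasure M (ball x r) / ennreal (2 * r)"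
      unfolding lower_density1_def by (intro less_LiminfD) simp
    then obtain \<delta> :: real where "0 < \<delta>"
      and heavy: "\<And>r. 0 < r \<Longrightarrow> r < \<delta> \<Longrightarrow> ennreal d < emeasure M (ball x r) / ennreal (2 * r)"
      unfolding eventually_at_right_field by auto
    then obtain r where "0 < r" "r < \<delta>" and le: "emeasure M (ball x r) \<le> ennreal (d * r)"
      using light \<open>0 < d\<close> unfolding vanishing_lower_density_def by blast
    have "emeasure M (ball x r) / ennreal (2 * r) \<le> ennreal (d * r) / ennreal (2 * r)"
      by (rule divide_right_mono_ennreal[OF le])
    also have "\<dots> \<le> ennreal d"
      using \<open>0 < r\<close> \<open>0 < d\<close> by (simp add: divide_ennreal ennreal_leI)
    finally show False
      using heavy[OF \<open>0 < r\<close> \<open>r < \<delta>\<close>] by simp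
  qed
  then show "lower_density1 M x = 0"
    using ennreal_le_epsilon[of 0 "lower_density1 M x"] by simp
qed

lemma lipschitz_image_Vitali_cover:
  fixes f :: "'a::euclidean_space \<Rightarrow> 'b::metric_space"
  assumes f: "L-lipschitz_on E f" and "L > 0" and \<rho>: "\<And>t. t \<in> E \<Longrightarrow> 0 < \<rho> t \<and> \<rho> t \<le> R"
  obtains D where "countable D" "D \<subseteq> E" "disjoint_family_on (\<lambda>t. ball t (\<rho> t / (5 * L))) D"
    "f ` E \<subseteq> (\<Union>t\<in>D. ball (f t) (\<rho> t))"
proof -
  define q where "q t = \<rho> t / (5 * L)" for t
  have q: "0 < q t \<and> q t \<le> R / (5 * L)" if "t \<in> E" for t
    using \<rho>[OF that] \<open>L > 0\<close> by (simp add: q_def divide_right_mono)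
  have "E \<subseteq> (\<Union>t\<in>E. ball t (q t))"
    using q by force
  then obtain D where D: "countable D" "D \<subseteq> E"
    and disj: "pairwise (\<lambda>s t. disjnt (ball s (q s)) (ball t (q t))) D"
    and cover: "E \<subseteq> (\<Union>t\<in>D. ball t (5 * q t))"
    by (rule Vitali_covering_lemma_balls[where a = "\<lambda>t. t" and r = q]) (rule q, assumption, blast)
  show ?thesis
  proof (rule that[OF D])
    show "disjoint_family_on (\<lambda>t. ball t (\<rho> t / (5 * L))) D"
      using disj by (auto simp: disjoint_family_on_def pairwise_def disjnt_def q_def)
    show "f ` E \<subseteq> (\<Union>t\<in>D. ball (f t) (\<rho> t))"
    proof (intro subsetI, elim imageE)
      fix x s assume "x = f s" "s \<in> E"
      then obtain t where t: "t \<in> D" "dist t s < 5 * q t"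
        using cover by auto
      have "dist (f t) (f s) \<le> L * dist t s"
        using t D \<open>s \<in> E\<close> by (intro lipschitz_onD[OF f]) auto
      also have "\<dots> < \<rho> t"
        using t \<open>L > 0\<close> by (simp add: q_def field_simps)
      finally show "x \<in> (\<Union>t\<in>D. ball (f t) (\<rho> t))"
        using t \<open>x = f s\<close> by auto
    qed
  qed
qed

lemma lipschitz_image_light_cover:
  fixes f :: "real \<Rightarrow> 'a::metric_space"
  assumes M: "sets M = sets borel" and f: "L-lipschitz_on E f" and "L > 0"
    and E: "E \<subseteq> {a..b}" and "a \<le> b" and "d \<ge> 0"
    and light: "\<And>t. t \<in> E \<Longrightarrow> \<exists>r>0. r < 5 * L \<and> emeasure M (ball (f t) r) \<le> ennreal (d * r)"
  obtains B where "B \<in> sets M" "f ` E \<subseteq> B" "emeasure M B \<le> ennreal (d * (5 * L / 2 * (b - a + 2)))"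
proof -
  obtain \<rho> where \<rho>: "\<And>t. t \<in> E \<Longrightarrow>
      0 < \<rho> t \<and> \<rho> t < 5 * L \<and> emeasure M (ball (f t) (\<rho> t)) \<le> ennreal (d * \<rho> t)"
    using light by metis
  then have "0 < \<rho> t \<and> \<rho> t \<le> 5 * L" if "t \<in> E" for t
    using that by (simp add: less_imp_le)
  then obtain D where D: "countable D" "D \<subseteq> E"
    and disj: "disjoint_family_on (\<lambda>t. ball t (\<rho> t / (5 * L))) D"
    and cover: "f ` E \<subseteq> (\<Union>t\<in>D. ball (f t) (\<rho> t))"
    by (rule lipschitz_image_Vitali_cover[OF f \<open>L > 0\<close>])
  have "emeasure M (\<Union>t\<in>D. ball (f t) (\<rho> t))
      \<le> ennreal (d * (5 * L / 2)) * emeasure lborel (\<Union>t\<in>D. ball t (\<rho> t / (5 * L)))"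
  proof (rule emeasure_UN_le_cmult_disjoint[OF \<open>countable D\<close> _ _ disj])
    fix t assume "t \<in> D"
    then have t: "t \<in> E" using D by auto
    have "emeasure lborel (ball t (\<rho> t / (5 * L))) = ennreal (2 * (\<rho> t / (5 * L)))"
      using \<rho>[OF t] \<open>L > 0\<close> by (simp add: ball_eq_greaterThanLessThan)
    then have "ennreal (d * (5 * L / 2)) * emeasure lborel (ball t (\<rho> t / (5 * L)))
        = ennreal (d * \<rho> t)"
      using \<open>L > 0\<close> \<open>d \<ge> 0\<close> \<rho>[OF t] by (simp flip: ennreal_mult)
    then show "emeasure M (ball (f t) (\<rho> t))
        \<le> ennreal (d * (5 * L / 2)) * emeasure lborel (ball t (\<rho> t / (5 * L)))"
      using \<rho>[OF t] by simp
  qed (auto simp: M)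
  also have "\<dots> \<le> ennreal (d * (5 * L / 2)) * emeasure lborel {a - 1..b + 1}"
  proof (intro mult_left_mono emeasure_mono UN_least subsetI)
    fix t s assume "t \<in> D" and s: "s \<in> ball t (\<rho> t / (5 * L))"
    then have "t \<in> E" using D by auto
    then have "\<rho> t / (5 * L) \<le> 1" using \<rho>[of t] \<open>L > 0\<close> by simp
    moreover have "a \<le> t" "t \<le> b" using \<open>t \<in> E\<close> E by auto
    ultimately show "s \<in> {a - 1..b + 1}" using s by (simp add: dist_real_def abs_less_iff)
  qed auto
  also have "\<dots> = ennreal (d * (5 * L / 2 * (b - a + 2)))"
    using \<open>L > 0\<close> \<open>d \<ge> 0\<close> \<open>a \<le> b\<close>
    by (subst emeasure_lborel_Icc) (auto simp: algebra_simps simp flip: ennreal_mult)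
  finally show ?thesis
    by (rule that[OF _ cover, rotated]) (simp add: M borel_open open_UN)
qed

lemma lipschitz_arc_null:
  fixes f :: "real \<Rightarrow> 'a::metric_space"
  assumes M: "sets M = sets borel" and AE: "AE x in M. vanishing_lower_density M x"
    and f: "C-lipschitz_on {a..b} f" and "a \<le> b"
  shows "f ` {a..b} \<in> null_sets M"
proof -
  define L where "L = C + 1"
  have "0 \<le> C" using f by (rule lipschitz_on_nonneg)
  then have "L > 0" and L: "L-lipschitz_on {a..b} f"
    using lipschitz_on_le[OF f] by (auto simp: L_def)
  have "space M = UNIV" using sets_eq_imp_space_eq[OF M] by simp
  then obtain N where N: "N \<in> null_sets M" and light: "\<And>x. x \<notin> N \<Longrightarrow> vanishing_lower_density M x"
    using AE by (auto elim!: AE_E3)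
  have le: "emeasure M (f ` {a..b}) \<le> 0 + ennreal e" if "e > 0" for e
  proof -
    define K where "K = 5 * L / 2 * (b - a + 2)"
    have "K > 0" using \<open>L > 0\<close> \<open>a \<le> b\<close> by (simp add: K_def)
    define d where "d = e / K"
    have "d > 0" using \<open>e > 0\<close> \<open>K > 0\<close> by (simp add: d_def)
    define E where "E = {t \<in> {a..b}. f t \<notin> N}"
    have "E \<subseteq> {a..b}" by (auto simp: E_def)
    moreover have "L-lipschitz_on E f"
      by (rule lipschitz_on_subset[OF L]) (auto simp: E_def)
    moreover have "\<exists>r>0. r < 5 * L \<and> emeasure M (ball (f t) r) \<le> ennreal (d * r)" if "t \<in> E" for t
      using light[of "f t"] that \<open>L > 0\<close> \<open>d > 0\<close> by (auto simp: E_def vanishing_lower_density_def)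
    ultimately obtain B where B: "B \<in> sets M" "f ` E \<subseteq> B" and le: "emeasure M B \<le> ennreal (d * K)"
      using lipschitz_image_light_cover[OF M, of L E f a b d, folded K_def] \<open>L > 0\<close> \<open>d > 0\<close> \<open>a \<le> b\<close>
      by (metis less_imp_le)
    have "emeasure M (f ` {a..b}) \<le> emeasure M (B \<union> N)"
      using B N by (intro emeasure_mono) (auto simp: E_def)
    also have "\<dots> = emeasure M B"
      by (rule emeasure_Un_null_set[OF B(1) N])
    also have "\<dots> \<le> 0 + ennreal e"
      using le \<open>K > 0\<close> by (simp add: d_def)
    finally show ?thesis .
  qed
  have "compact (f ` {a..b})"
    using f by (intro compact_continuous_image lipschitz_on_continuous_on) auto
  with ennreal_le_epsilon[OF le] show ?thesis
    by (simp add: null_sets_def M borel_compact)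
qed

lemma purely_1_unrectifiableI:
  assumes M: "sets M = sets borel" and AE: "AE x in M. lower_density1 M x = 0"
  shows "purely_1_unrectifiable M"
  unfolding purely_1_unrectifiable_def
proof (intro allI impI, elim exE)
  fix f :: "real \<Rightarrow> real^2" and C assume "C-lipschitz_on UNIV f"
  then have "f ` {- real n..real n} \<in> null_sets M" for n
    using AE by (intro lipschitz_arc_null[OF M, where C = C])
      (auto simp: lower_density1_eq_0_iff intro: lipschitz_on_subset)
  then have "(\<Union>n. f ` {- real n..real n}) \<in> null_sets M"
    by (rule null_sets_UN)
  moreover have "range f = (\<Union>n. f ` {- real n..real n})"
  proof -
    have "t \<in> (\<Union>n. {- real n..real n})" for t
      using real_arch_simple[of "\<bar>t\<bar>"] by (auto simp: abs_le_iff minus_le_iff)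
    then have "(\<Union>n. {- real n..real n}) = UNIV" by blast
    then show ?thesis by (simp flip: image_UN)
  qed
  ultimately show "emeasure M (range f) = 0" by auto
qed

section \<open>Dyadic numbers and dyadic squares\<close>

definition dyadic :: "nat \<Rightarrow> real \<Rightarrow> bool" where
  "dyadic j x \<longleftrightarrow> x * 2 ^ j \<in> \<int>"

definition dyadic_floor :: "nat \<Rightarrow> real \<Rightarrow> real" where
  "dyadic_floor j x = of_int \<lfloor>x * 2 ^ j\<rfloor> * (1/2) ^ j"

lemma dyadic_0 [simp]: "dyadic j 0"
  by (simp add: dyadic_def)

lemma dyadic_add: "dyadic j x \<Longrightarrow> dyadic j y \<Longrightarrow> dyadic j (x + y)"
  by (simp add: dyadic_def distrib_right)

lemma dyadic_diff: "dyadic j x \<Longrightarrow> dyadic j y \<Longrightarrow> dyadic j (x - y)"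
  by (simp add: dyadic_def left_diff_distrib)

lemma dyadic_mult_of_nat: "dyadic j x \<Longrightarrow> dyadic j (x * of_nat m)"
  using Ints_mult[of "x * 2 ^ j" "of_nat m"] by (simp add: dyadic_def mult_ac)

lemma dyadic_mono:
  assumes "dyadic i x" "i \<le> j"
  shows "dyadic j x"
proof -
  have "x * 2 ^ i * 2 ^ (j - i) \<in> \<int>"
    using assms(1) unfolding dyadic_def by (rule Ints_mult) simp
  then show ?thesis
    using \<open>i \<le> j\<close> by (simp add: dyadic_def mult.assoc flip: power_add)
qed

lemma dyadic_power: "i \<le> j \<Longrightarrow> dyadic j ((1/2) ^ i)"
  by (rule dyadic_mono[of i]) (simp_all add: dyadic_def power_one_over)

lemma dyadic_dyadic_floor: "dyadic j (dyadic_floor j x)"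
  by (simp add: dyadic_def dyadic_floor_def power_one_over)

lemma dyadic_floor_le: "dyadic_floor j x \<le> x"
  using of_int_floor_le[of "x * 2 ^ j"] by (simp add: dyadic_floor_def field_simps)

lemma less_dyadic_floor_add: "x < dyadic_floor j x + (1/2) ^ j"
  using floor_less_iff[of "x * 2 ^ j" "\<lfloor>x * 2 ^ j\<rfloor> + 1"] by (simp add: dyadic_floor_def field_simps)

lemma dyadic_le_dyadic_floor_iff:
  assumes "dyadic j u"
  shows "u \<le> dyadic_floor j x \<longleftrightarrow> u \<le> x"
proof -
  obtain z where "u * 2 ^ j = of_int z"
    using assms by (auto simp: dyadic_def elim: Ints_cases)
  then have u: "u = of_int z * (1/2) ^ j"
    by (simp add: field_simps)
  have "u \<le> dyadic_floor j x \<longleftrightarrow> z \<le> \<lfloor>x * 2 ^ j\<rfloor>"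
    by (simp add: u dyadic_floor_def)
  also have "\<dots> \<longleftrightarrow> u \<le> x"
    by (simp add: u le_floor_iff field_simps)
  finally show ?thesis .
qed

lemma dyadic_floor_of_dyadic: "dyadic j u \<Longrightarrow> dyadic_floor j u = u"
  using dyadic_le_dyadic_floor_iff[of j u u] dyadic_floor_le[of j u] by simp

lemma dyadic_less_imp_add_le:
  assumes "dyadic j x" "dyadic j y" "x < y"
  shows "x + (1/2) ^ j \<le> y"
proof -
  obtain z w where zw: "x * 2 ^ j = of_int z" "y * 2 ^ j = of_int w"
    using assms(1,2) by (auto simp: dyadic_def elim!: Ints_cases)
  have "x * 2 ^ j < y * 2 ^ j"
    using \<open>x < y\<close> by simp
  then have "x * 2 ^ j + 1 \<le> y * 2 ^ j"
    unfolding zw of_int_less_iff by linarith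
  then show ?thesis
    by (simp add: field_simps)
qed

lemma dyadic_floor_eqI:
  assumes "dyadic j u" "u \<le> x" "x < u + (1/2) ^ j"
  shows "dyadic_floor j x = u"
proof (rule antisym)
  show "u \<le> dyadic_floor j x"
    using assms by (simp add: dyadic_le_dyadic_floor_iff)
  have "dyadic_floor j x < u + (1/2) ^ j"
    using dyadic_floor_le[of j x] assms(3) by simp
  then show "dyadic_floor j x \<le> u"
    using dyadic_less_imp_add_le[OF assms(1) dyadic_dyadic_floor, of x] by linarith
qed

lemma dyadic_floor_add: "dyadic j u \<Longrightarrow> dyadic_floor j (u + x) = u + dyadic_floor j x"
  using dyadic_floor_le[of j x] less_dyadic_floor_add[of x j]
  by (intro dyadic_floor_eqI dyadic_add dyadic_dyadic_floor) auto

lemma dyadic_floor_dyadic_floor: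
  assumes "i \<le> j"
  shows "dyadic_floor i (dyadic_floor j x) = dyadic_floor i x"
proof (rule dyadic_floor_eqI[OF dyadic_dyadic_floor])
  have "dyadic j (dyadic_floor i x)"
    using dyadic_dyadic_floor assms by (rule dyadic_mono)
  then show "dyadic_floor i x \<le> dyadic_floor j x"
    by (simp add: dyadic_le_dyadic_floor_iff dyadic_floor_le)
  show "dyadic_floor j x < dyadic_floor i x + (1/2) ^ i"
    using dyadic_floor_le less_dyadic_floor_add by (rule le_less_trans)
qed

lemma dyadic_floor_power: "dyadic_floor j ((1/2) ^ k) = (if k \<le> j then (1/2) ^ k else 0)"
proof (cases "k \<le> j")
  case False
  then have "(1/2::real) ^ k < (1/2) ^ j"
    by (simp add: power_strict_decreasing)
  with False show ?thesis
    using dyadic_floor_eqI[of j 0 "(1/2) ^ k"] by simp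
qed (simp add: dyadic_floor_of_dyadic dyadic_power)

lemma multiples_in_interval_eq:
  fixes g :: real
  assumes "g > 0"
  shows "{p::nat. g * of_int z \<le> g * real p \<and> g * real p < g * of_int w} = {nat z..<nat w}"
proof -
  have "g * of_int z \<le> g * real p \<and> g * real p < g * of_int w \<longleftrightarrow> z \<le> int p \<and> int p < w" for p
    using assms by (simp del: of_int_le_iff of_int_less_iff
        add: of_int_le_iff[where 'a = real, symmetric] of_int_less_iff[where 'a = real, symmetric])
  then show ?thesis
    by (simp add: set_eq_iff nat_le_iff zless_nat_eq_int_zless)
qed

definition dyadic_square_at :: "nat \<Rightarrow> real^2 \<Rightarrow> (real^2) set" where
  "dyadic_square_at j x = half_open_square (\<chi> k. dyadic_floor j (x $ k)) ((1/2) ^ j)"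

lemma side_length_dyadic_square_at [simp]: "side_length (dyadic_square_at j x) = (1/2) ^ j"
  by (simp add: dyadic_square_at_def)

lemma mem_dyadic_square_at_iff:
  "y \<in> dyadic_square_at j x \<longleftrightarrow> (\<forall>k. dyadic_floor j (y $ k) = dyadic_floor j (x $ k))"
proof -
  have "dyadic_floor j a = dyadic_floor j b \<longleftrightarrow>
      dyadic_floor j b \<le> a \<and> a < dyadic_floor j b + (1/2) ^ j" for a b
    using dyadic_floor_le[of j a] less_dyadic_floor_add[of a j]
    by (metis dyadic_dyadic_floor dyadic_floor_eqI)
  then show ?thesis
    by (simp add: dyadic_square_at_def half_open_square_def)
qed

lemma mem_triple_dyadic_square_at_iff:
  "y \<in> triple (dyadic_square_at j x) \<longleftrightarrow>
     (\<forall>k. dyadic_floor j (x $ k) - (1/2) ^ j \<le> y $ k \<and>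
       y $ k < dyadic_floor j (x $ k) + 2 * (1/2) ^ j)"
  by (simp add: dyadic_square_at_def triple_half_open_square)
    (simp add: half_open_square_def algebra_simps)

lemma half_open_square_borel [measurable]: "half_open_square a s \<in> sets borel"
  unfolding half_open_square_def forall_2 by measurable

lemma dyadic_square_at_borel [measurable]: "dyadic_square_at j x \<in> sets borel"
  by (simp add: dyadic_square_at_def)

lemma triple_dyadic_square_at_borel [measurable]: "triple (dyadic_square_at j x) \<in> sets borel"
  by (simp add: dyadic_square_at_def triple_half_open_square)

lemma dyadic_squares_containing_eq:
  "{Q \<in> dyadic_squares. side_length Q \<le> 1 \<and> x \<in> Q} = range (\<lambda>j. dyadic_square_at j x)"
proof (intro equalityI subsetI; elim CollectE conjE rangeE)
  fix Q assume "Q \<in> dyadic_squares" "side_length Q \<le> 1" "x \<in> Q"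
  then obtain j k l :: int where Q: "Q =
      half_open_square (vector [of_int k * 2 powi (-j), of_int l * 2 powi (-j)]) (2 powi (-j))"
    by (auto simp: dyadic_squares_def)
  then have "(2::real) powi (-j) \<le> 1"
    using \<open>side_length Q \<le> 1\<close> by simp
  then have "j \<ge> 0"
    using one_less_power_int[of "2::real" "-j"] by linarith
  then obtain n where [simp]: "j = int n"
    by (rule nonneg_int_cases)
  have side: "2 powi (-j) = (1/2::real) ^ n"
    by (simp add: power_int_minus power_one_over inverse_eq_divide)
  have "dyadic n (of_int m * (1/2) ^ n)" for m
    by (simp add: dyadic_def power_one_over)
  then have "dyadic_floor n (x $ i) = vector [of_int k * (1/2) ^ n, of_int l * (1/2) ^ n] $ i"
    for i :: 2
    using \<open>x \<in> Q\<close> exhaust_2[of i] unfolding Q side half_open_square_def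
    by (auto simp: forall_2 intro: dyadic_floor_eqI)
  then have "Q = dyadic_square_at n x"
    unfolding Q side dyadic_square_at_def by (simp add: vec_lambda_eta)
  then show "Q \<in> range (\<lambda>j. dyadic_square_at j x)"
    by (rule range_eqI)
next
  fix Q j assume Q: "Q = dyadic_square_at j x"
  have "Q = half_open_square
      (vector [of_int \<lfloor>x $ 1 * 2 ^ j\<rfloor> * 2 powi (- int j),
        of_int \<lfloor>x $ 2 * 2 ^ j\<rfloor> * 2 powi (- int j)])
      (2 powi (- int j))"
    unfolding Q dyadic_square_at_def
    by (intro arg_cong2[where f = half_open_square])
      (simp_all add: vec_eq_iff forall_2 dyadic_floor_def power_int_minus power_one_over
        inverse_eq_divide)
  then have "Q \<in> dyadic_squares"
    unfolding dyadic_squares_def by blast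
  then show "Q \<in> {Q \<in> dyadic_squares. side_length Q \<le> 1 \<and> x \<in> Q}"
    using Q by (simp add: mem_dyadic_square_at_iff power_le_one)
qed

section \<open>The Jones function\<close>

definition jones_summand :: "(real^2) measure \<Rightarrow> (real^2) set \<Rightarrow> ennreal" where
  "jones_summand M Q = ennreal ((beta2 M (triple Q))\<^sup>2) * (ennreal (side_length Q) / emeasure M Q)"

lemma jones1_eq_suminf: "jones1 M x = (\<Sum>j. jones_summand M (dyadic_square_at j x))"
proof -
  have inj: "inj (\<lambda>j. dyadic_square_at j x)"
  proof (rule injI)
    fix i j assume "dyadic_square_at i x = dyadic_square_at j x"
    then have "(1/2::real) ^ i = (1/2) ^ j"
      using side_length_dyadic_square_at by metis
    then show "i = j"
      by (simp add: power_one_over)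
  qed
  have "jones1 M x = infsum (jones_summand M) {Q \<in> dyadic_squares. side_length Q \<le> 1 \<and> x \<in> Q}"
    unfolding jones1_def jones_summand_def
    by (rule infsum_cong_neutral) (auto simp: indicator_def)
  also have "\<dots> = (\<Sum>\<^sub>\<infinity>j\<in>UNIV. jones_summand M (dyadic_square_at j x))"
    unfolding dyadic_squares_containing_eq by (subst infsum_reindex[OF inj]) (simp add: o_def)
  also have "\<dots> = (\<Sum>j. jones_summand M (dyadic_square_at j x))"
    by (intro sums_unique has_sum_imp_sums has_sum_infsum nonneg_summable_on_complete) simp
  finally show ?thesis .
qed

lemma diameter_half_open_square_ge:
  assumes "s > 0"
  shows "s \<le> diameter (half_open_square a s)"
proof (rule dense_le_bounded[OF assms])
  fix t assume t: "0 < t" "t < s"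
  have "bounded (half_open_square a s)"
    by (rule bounded_subset[OF bounded_cbox[of a "\<chi> k. a $ k + s"]])
      (force simp: half_open_square_def mem_box_cart intro: less_imp_le)
  then have "dist a (\<chi> k. a $ k + t) \<le> diameter (half_open_square a s)"
    using t by (intro diameter_bounded_bound) (auto simp: half_open_square_def)
  moreover have "t \<le> dist a (\<chi> k. a $ k + t)"
    using dist_vec_nth_le[of a 1 "\<chi> k. a $ k + t"] t by (simp add: dist_real_def)
  ultimately show "t \<le> diameter (half_open_square a s)" by simp
qed

lemma horizontal_line_in_affine_lines: "{y :: real^2. y $ 2 = h} \<in> affine_lines"
proof -
  have "{y :: real^2. y $ 2 = h} = {y. axis 2 1 \<bullet> y = h}"
    by (simp add: cart_eq_inner_axis inner_commute)
  then show ?thesis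
    by (simp add: affine_lines_def affine_hyperplane)
qed

lemma infdist_horizontal_line: "infdist y {z :: real^2. z $ 2 = h} = \<bar>y $ 2 - h\<bar>"
proof (rule antisym)
  define z :: "real^2" where "z = (\<chi> k. if k = 2 then h else y $ k)"
  have "infdist y {z :: real^2. z $ 2 = h} \<le> dist y z"
    by (rule infdist_le) (simp add: z_def)
  also have "\<dots> = \<bar>y $ 2 - h\<bar>"
    by (simp add: dist_vec_def L2_set_def sum_2 z_def dist_real_def)
  finally show "infdist y {z :: real^2. z $ 2 = h} \<le> \<bar>y $ 2 - h\<bar>" .
  have "\<bar>y $ 2 - h\<bar> \<le> dist y z" if "z $ 2 = h" for z :: "real^2"
    using dist_vec_nth_le[of y 2 z] that by (simp add: dist_real_def)
  moreover have "z \<in> {z. z $ 2 = h}"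
    by (simp add: z_def)
  ultimately show "\<bar>y $ 2 - h\<bar> \<le> infdist y {z :: real^2. z $ 2 = h}"
    by (auto simp: infdist_def intro!: cINF_greatest)
qed

lemma beta2_sq_le_horizontal_line:
  "(beta2 M Q)\<^sup>2 \<le> (LINT y:Q|M. (y $ 2 - h)\<^sup>2) / ((diameter Q)\<^sup>2 * measure M Q)"
proof -
  define \<beta> where "\<beta> L = 1 / measure M Q * (LINT y:Q|M. (infdist y L / diameter Q)\<^sup>2)" for L
  have nonneg: "0 \<le> \<beta> L" for L
    unfolding \<beta>_def set_lebesgue_integral_def by (intro mult_nonneg_nonneg integral_nonneg_AE) auto
  have line: "{y. y $ 2 = h} \<in> affine_lines"
    by (rule horizontal_line_in_affine_lines)
  have "beta2 M Q \<le> sqrt (\<beta> {y. y $ 2 = h})"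
    unfolding beta2_def \<beta>_def[symmetric]
    using nonneg line by (intro cINF_lower bdd_belowI[where m = 0]) auto
  moreover have "0 \<le> beta2 M Q"
    unfolding beta2_def \<beta>_def[symmetric]
    using nonneg line by (intro cINF_greatest) auto
  ultimately have "(beta2 M Q)\<^sup>2 \<le> \<beta> {y. y $ 2 = h}"
    using power_mono[of "beta2 M Q" "sqrt (\<beta> {y. y $ 2 = h})" 2] nonneg by simp
  also have "\<dots> = (LINT y:Q|M. (y $ 2 - h)\<^sup>2) / ((diameter Q)\<^sup>2 * measure M Q)"
    by (simp add: \<beta>_def infdist_horizontal_line power_divide)
  finally show ?thesis .
qed

lemma jones_summand_le:
  assumes moment: "(LINT y:triple Q|M. (y $ 2 - h)\<^sup>2) \<le> c * measure M (triple Q)"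
    and Q: "Q = half_open_square a s" and "s > 0" "c \<ge> 0"
    and m: "ennreal m \<le> emeasure M Q" "m > 0"
  shows "jones_summand M Q \<le> ennreal (c / (s * m))"
proof -
  define D where "D = diameter (triple Q)"
  have "s \<le> D"
    using diameter_half_open_square_ge[of "3 * s" "\<chi> i. a $ i - s"] \<open>s > 0\<close>
    unfolding D_def Q triple_half_open_square[OF \<open>s > 0\<close>] by simp
  have "(beta2 M (triple Q))\<^sup>2 \<le> (LINT y:triple Q|M. (y $ 2 - h)\<^sup>2) / (D\<^sup>2 * measure M (triple Q))"
    unfolding D_def
    by (rule beta2_sq_le_horizontal_line)
  also have "\<dots> \<le> c * measure M (triple Q) / (D\<^sup>2 * measure M (triple Q))"
    by (intro divide_right_mono moment) simp
  also have "\<dots> \<le> c / D\<^sup>2"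
    using \<open>c \<ge> 0\<close> by (cases "measure M (triple Q) = 0") auto
  also have "\<dots> \<le> c / s\<^sup>2"
    using \<open>s > 0\<close> \<open>c \<ge> 0\<close> \<open>s \<le> D\<close> by (intro divide_left_mono power_mono mult_pos_pos) auto
  finally have "(beta2 M (triple Q))\<^sup>2 \<le> c / s\<^sup>2" .
  moreover have "ennreal s / emeasure M Q \<le> ennreal (s / m)"
  proof (rule divide_le_posI_ennreal)
    show "0 < emeasure M Q"
      using m by (meson ennreal_less_zero_iff less_le_trans)
    have "ennreal s = ennreal m * ennreal (s / m)"
      using \<open>s > 0\<close> \<open>m > 0\<close> by (simp flip: ennreal_mult)
    also have "\<dots> \<le> emeasure M Q * ennreal (s / m)"
      by (intro mult_right_mono m) simp
    finally show "ennreal s \<le> emeasure M Q * ennreal (s / m)" .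
  qed
  ultimately have "jones_summand M Q \<le> ennreal (c / s\<^sup>2) * ennreal (s / m)"
    unfolding jones_summand_def Q using \<open>s > 0\<close> by (intro mult_mono ennreal_leI) auto
  also have "\<dots> = ennreal (c / (s * m))"
    using \<open>s > 0\<close> \<open>c \<ge> 0\<close> \<open>m > 0\<close> by (simp add: power2_eq_square flip: ennreal_mult)
  finally show ?thesis .
qed

section \<open>Cantor measures with prescribed digits\<close>

lemma compact_PiE_finite:
  fixes D :: "'i \<Rightarrow> 'a::topological_space set"
  assumes "\<And>n. finite (D n)"
  shows "compact (PiE UNIV D)"
  using compactin_PiE[of "\<lambda>_. euclidean" UNIV D] assms
  by (simp add: euclidean_product_topology finite_imp_compact)

text \<open>The Cantor set consists of the sums of the digits. The cubes of generation \<open>n\<close> have side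
  length \<open>side n\<close> and their lower corners are the partial sums of \<open>n\<close> digits.\<close>

locale cantor_scheme =
  fixes digits :: "nat \<Rightarrow> (real^'d) set" and side :: "nat \<Rightarrow> real"
  assumes finite_digits [simp]: "finite (digits n)"
    and digits_nonempty [simp]: "digits n \<noteq> {}"
    and side_pos [simp]: "0 < side n"
    and digit_nonneg: "v \<in> digits n \<Longrightarrow> 0 \<le> v $ k"
    and digit_add_le: "v \<in> digits n \<Longrightarrow> v $ k + 2 * side (Suc n) \<le> side n"
    and digits_separated:
      "v \<in> digits n \<Longrightarrow> w \<in> digits n \<Longrightarrow> v \<noteq> w \<Longrightarrow> \<exists>k. 2 * side (Suc n) \<le> \<bar>v $ k - w $ k\<bar>"
begin

definition codes :: "(nat \<Rightarrow> real^'d) set" where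
  "codes = PiE UNIV digits"

definition corner :: "nat \<Rightarrow> (nat \<Rightarrow> real^'d) \<Rightarrow> real^'d" where
  "corner n \<omega> = (\<Sum>i<n. \<omega> i)"

definition point :: "(nat \<Rightarrow> real^'d) \<Rightarrow> real^'d" where
  "point \<omega> = (\<Sum>i. \<omega> i)"

lemma codesD: "\<omega> \<in> codes \<Longrightarrow> \<omega> n \<in> digits n"
  by (auto simp: codes_def)

lemma corner_0 [simp]: "corner 0 \<omega> = 0"
  by (simp add: corner_def)

lemma corner_Suc: "corner (Suc n) \<omega> = corner n \<omega> + \<omega> n"
  by (simp add: corner_def)

lemma corner_cong: "(\<And>i. i < n \<Longrightarrow> \<omega> i = \<omega>' i) \<Longrightarrow> corner n \<omega> = corner n \<omega>'"
  by (simp add: corner_def)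

lemma side_nonneg [simp]: "0 \<le> side n"
  by (simp add: less_imp_le)

lemma side_Suc_le: "2 * side (Suc n) \<le> side n"
proof -
  obtain v where "v \<in> digits n" using digits_nonempty by blast
  then show ?thesis
    using digit_nonneg[of v n undefined] digit_add_le[of v n undefined] by linarith
qed

lemma side_antimono: "n \<le> m \<Longrightarrow> side m \<le> side n"
proof (induction m rule: dec_induct)
  case (step m)
  then show ?case using side_Suc_le[of m] side_pos[of "Suc m"] by linarith
qed simp

lemma side_le_geometric: "side n \<le> side 0 * (1/2) ^ n"
proof (induction n)
  case (Suc n)
  then show ?case using side_Suc_le[of n] by simp
qed simp

lemma norm_digit_le:
  assumes "v \<in> digits n"
  shows "norm v \<le> real CARD('d) * side 0 * (1/2) ^ n"
proof -
  have "norm v \<le> (\<Sum>k\<in>UNIV. \<bar>v $ k\<bar>)"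
    by (rule norm_le_l1_cart)
  also have "\<dots> \<le> (\<Sum>k\<in>(UNIV :: 'd set). side n)"
  proof (rule sum_mono)
    show "\<bar>v $ k\<bar> \<le> side n" for k
      using digit_nonneg[OF assms, of k] digit_add_le[OF assms, of k] side_pos[of "Suc n"]
      by linarith
  qed
  also have "\<dots> \<le> real CARD('d) * side 0 * (1/2) ^ n"
    using side_le_geometric[of n] by simp
  finally show ?thesis .
qed

lemma corner_tendsto_point:
  assumes "\<omega> \<in> codes"
  shows "(\<lambda>n. corner n \<omega>) \<longlonglongrightarrow> point \<omega>"
proof -
  have "summable (\<lambda>n. real CARD('d) * side 0 * (1/2) ^ n)"
    by (intro summable_mult summable_geometric) simp
  then have "summable \<omega>"
    by (rule summable_comparison_test') (rule norm_digit_le[OF codesD[OF assms]])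
  then show ?thesis
    unfolding corner_def point_def by (rule summable_LIMSEQ)
qed

lemma corner_nested:
  assumes "\<omega> \<in> codes" "n \<le> m"
  shows "corner n \<omega> $ k \<le> corner m \<omega> $ k \<and> corner m \<omega> $ k + side m \<le> corner n \<omega> $ k + side n"
  using assms(2)
proof (induction m rule: dec_induct)
  case (step m)
  have "0 \<le> \<omega> m $ k" "\<omega> m $ k + side (Suc m) \<le> side m"
    using digit_nonneg[OF codesD[OF assms(1)]] digit_add_le[OF codesD[OF assms(1)], of m k]
      side_pos[of "Suc m"]
    by (auto simp del: side_pos)
  with step show ?case by (simp add: corner_Suc)
qed simp

lemma corner_le_point:
  assumes "\<omega> \<in> codes"
  shows "corner n \<omega> $ k \<le> point \<omega> $ k"
  using tendsto_vec_nth[OF corner_tendsto_point[OF assms]]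
  by (rule LIMSEQ_le_const) (use corner_nested[OF assms] in blast)

lemma point_less_corner_add:
  assumes "\<omega> \<in> codes"
  shows "point \<omega> $ k < corner n \<omega> $ k + side n"
proof -
  have "corner m \<omega> $ k \<le> corner (Suc n) \<omega> $ k + side (Suc n)" if "Suc n \<le> m" for m
    using corner_nested[OF assms that, of k] side_pos[of m] by linarith
  then have "point \<omega> $ k \<le> corner (Suc n) \<omega> $ k + side (Suc n)"
    by (intro LIMSEQ_le_const2[OF tendsto_vec_nth[OF corner_tendsto_point[OF assms]]]) blast
  also have "\<dots> < corner n \<omega> $ k + side n"
    using digit_add_le[OF codesD[OF assms], of n k] side_pos[of "Suc n"]
    unfolding corner_Suc vector_add_component by linarith
  finally show ?thesis .
qed

lemma points_separated:
  assumes "\<omega> \<in> codes" "\<omega>' \<in> codes" "i < n" "\<omega> i \<noteq> \<omega>' i"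
  shows "\<exists>k. side n \<le> \<bar>point \<omega> $ k - point \<omega>' $ k\<bar>"
proof -
  define m where "m = (LEAST i. \<omega> i \<noteq> \<omega>' i)"
  have "\<omega> m \<noteq> \<omega>' m"
    unfolding m_def by (rule LeastI, rule assms)
  have "m \<le> i"
    unfolding m_def by (rule Least_le, rule assms)
  have "corner m \<omega> = corner m \<omega>'"
    using not_less_Least by (intro corner_cong) (auto simp: m_def)
  obtain k where "2 * side (Suc m) \<le> \<bar>\<omega> m $ k - \<omega>' m $ k\<bar>"
    using digits_separated[OF codesD codesD] assms(1,2) \<open>\<omega> m \<noteq> \<omega>' m\<close> by blast
  also have "\<omega> m $ k - \<omega>' m $ k = corner (Suc m) \<omega> $ k - corner (Suc m) \<omega>' $ k"
    using \<open>corner m \<omega> = corner m \<omega>'\<close> by (simp add: corner_Suc)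
  finally have "side (Suc m) \<le> \<bar>point \<omega> $ k - point \<omega>' $ k\<bar>"
    using corner_le_point[OF assms(1), of "Suc m" k] corner_le_point[OF assms(2), of "Suc m" k]
      point_less_corner_add[OF assms(1), of k "Suc m"]
      point_less_corner_add[OF assms(2), of k "Suc m"]
    by linarith
  moreover have "side n \<le> side (Suc m)"
    using \<open>m \<le> i\<close> \<open>i < n\<close> by (intro side_antimono) simp
  ultimately show ?thesis by (intro exI[of _ k]) linarith
qed

lemma continuous_on_point: "continuous_on codes point"
proof -
  have "uniform_limit codes (\<lambda>n \<omega>. \<Sum>i<n. \<omega> i) (\<lambda>\<omega>. \<Sum>i. \<omega> i) sequentially"
    by (rule Weierstrass_m_test[OF norm_digit_le[OF codesD]]) (auto intro: summable_mult)
  then show ?thesis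
    unfolding point_def
    by (rule uniform_limit_theorem[rotated])
      (auto intro!: always_eventually continuous_on_sum
        continuous_on_subset[OF continuous_on_product_coordinates])
qed

lemma compact_point_image:
  assumes "\<And>n. D n \<subseteq> digits n"
  shows "compact (point ` PiE UNIV D)"
proof (rule compact_continuous_image)
  have "PiE UNIV D \<subseteq> codes"
    using assms by (auto simp: codes_def PiE_iff)
  then show "continuous_on (PiE UNIV D) point"
    by (rule continuous_on_subset[OF continuous_on_point])
  show "compact (PiE UNIV D)"
    using assms by (intro compact_PiE_finite) (meson finite_digits finite_subset)
qed

definition code_measure :: "(nat \<Rightarrow> real^'d) measure" where
  "code_measure = PiM UNIV (\<lambda>n. uniform_count_measure (digits n))"

definition mu :: "(real^'d) measure" where
  "mu = distr code_measure borel point"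

definition mass :: "nat \<Rightarrow> real" where
  "mass n = (\<Prod>i<n. 1 / real (card (digits i)))"

lemma mass_pos [simp]: "0 < mass n"
  by (auto simp: mass_def card_gt_0_iff intro!: prod_pos)

lemma prob_space_digits: "prob_space (uniform_count_measure (digits n))"
  by (intro prob_space_uniform_count_measure) auto

sublocale codes: prob_space code_measure
  unfolding code_measure_def by (intro prob_space_PiM prob_space_digits)

lemma space_code_measure [simp]: "space code_measure = codes"
  by (simp add: code_measure_def space_PiM codes_def space_uniform_count_measure)

lemma sets_cylinder:
  assumes "finite J" "\<And>i. i \<in> J \<Longrightarrow> A i \<subseteq> digits i"
  shows "{\<omega> \<in> codes. \<forall>i\<in>J. \<omega> i \<in> A i} \<in> sets code_measure"
proof -
  have "{\<omega> \<in> space code_measure. \<omega> i \<in> A i} \<in> sets code_measure" if "i \<in> J" for i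
    unfolding code_measure_def using assms(2)[OF that]
    by (intro sets_Collect_single')
      (auto simp: sets_uniform_count_measure space_uniform_count_measure Collect_conj_eq)
  then show ?thesis
    using sets.sets_Collect_finite_All[of J code_measure "\<lambda>i \<omega>. \<omega> i \<in> A i"] assms(1) by simp
qed

lemma measure_cylinder:
  assumes "finite J" "\<And>i. i \<in> J \<Longrightarrow> A i \<subseteq> digits i"
  shows "measure code_measure {\<omega> \<in> codes. \<forall>i\<in>J. \<omega> i \<in> A i}
    = (\<Prod>i\<in>J. real (card (A i)) / real (card (digits i)))"
proof -
  interpret product_prob_space "\<lambda>n. uniform_count_measure (digits n)" UNIV
    by (intro product_prob_spaceI prob_space_digits)
  have "emeasure code_measure {\<omega> \<in> codes. \<forall>i\<in>J. \<omega> i \<in> A i}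
      = (\<Prod>i\<in>J. emeasure (uniform_count_measure (digits i)) (A i))"
    using emeasure_PiM_Collect[of J A] assms
    by (simp flip: code_measure_def space_code_measure add: sets_uniform_count_measure)
  also have "\<dots> = (\<Prod>i\<in>J. ennreal (real (card (A i)) / real (card (digits i))))"
    using assms by (intro prod.cong) (auto simp: emeasure_uniform_count_measure)
  also have "\<dots> = ennreal (\<Prod>i\<in>J. real (card (A i)) / real (card (digits i)))"
    by (simp add: prod_ennreal)
  finally show ?thesis by (simp add: measure_def prod_nonneg)
qed

definition branches :: "(nat \<Rightarrow> real^'d) \<Rightarrow> nat \<Rightarrow> (real^'d) set \<Rightarrow> (nat \<Rightarrow> real^'d) set" where
  "branches \<xi> n T = {\<omega> \<in> codes. (\<forall>i<n. \<omega> i = \<xi> i) \<and> \<omega> n \<in> T}"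

lemma
  assumes "\<xi> \<in> codes" "T \<subseteq> digits n"
  shows sets_branches: "branches \<xi> n T \<in> sets code_measure"
    and measure_branches: "measure code_measure (branches \<xi> n T) = mass (Suc n) * real (card T)"
proof -
  define A where "A i = (if i < n then {\<xi> i} else T)" for i
  have eq: "branches \<xi> n T = {\<omega> \<in> codes. \<forall>i\<in>{..n}. \<omega> i \<in> A i}"
    by (auto simp: A_def le_less branches_def)
  have A: "A i \<subseteq> digits i" if "i \<in> {..n}" for i
    using that assms codesD by (auto simp: A_def le_less)
  show "branches \<xi> n T \<in> sets code_measure"
    unfolding eq by (intro sets_cylinder A) auto
  have "measure code_measure (branches \<xi> n T)
      = (\<Prod>i\<in>{..n}. real (card (A i)) / real (card (digits i)))"
    unfolding eq by (intro measure_cylinder A) auto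
  also have "\<dots> = mass (Suc n) * real (card T)"
    by (simp add: lessThan_Suc_atMost[symmetric] A_def mass_def)
  finally show "measure code_measure (branches \<xi> n T) = mass (Suc n) * real (card T)" .
qed

lemma AE_infinitely_often_digit_not_in:
  assumes A: "\<And>n. A n \<subseteq> digits n"
    and q: "\<And>n. real (card (A n)) \<le> q * real (card (digits n))" "0 \<le> q" "q < 1"
  shows "AE \<omega> in code_measure. \<exists>\<^sub>\<infinity>n. \<omega> n \<notin> A n"
proof -
  have "AE \<omega> in code_measure. \<exists>m\<ge>n. \<omega> m \<notin> A m" for n
  proof -
    define C where "C k = {\<omega> \<in> codes. \<forall>i\<in>{n..<n + k}. \<omega> i \<in> A i}" for k
    have C: "C k \<in> sets code_measure" for k
      unfolding C_def by (intro sets_cylinder A) auto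
    have "measure code_measure (\<Inter>k. C k) \<le> q ^ k" for k
    proof -
      have "measure code_measure (\<Inter>k. C k) \<le> measure code_measure (C k)"
        using C by (intro codes.finite_measure_mono) auto
      also have "\<dots> = (\<Prod>i\<in>{n..<n + k}. real (card (A i)) / real (card (digits i)))"
        unfolding C_def by (intro measure_cylinder A) auto
      also have "\<dots> \<le> (\<Prod>i\<in>{n..<n + k}. q)"
        using q(1) by (intro prod_mono) (auto simp: divide_le_eq card_gt_0_iff)
      finally show ?thesis by simp
    qed
    moreover have "(\<lambda>k. q ^ k) \<longlonglongrightarrow> 0"
      using \<open>0 \<le> q\<close> \<open>q < 1\<close> by (rule LIMSEQ_realpow_zero)
    ultimately have "measure code_measure (\<Inter>k. C k) \<le> 0"
      by (intro LIMSEQ_le_const) auto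
    then have "(\<Inter>k. C k) \<in> null_sets code_measure"
      using C by (intro null_setsI sets.countable_INT)
        (auto simp: codes.emeasure_eq_measure measure_le_0_iff)
    then show ?thesis
      by (rule AE_I') (auto simp: C_def)
  qed
  then have "AE \<omega> in code_measure. \<forall>n. \<exists>m\<ge>n. \<omega> m \<notin> A m"
    by (subst AE_all_countable) blast
  then show ?thesis by (simp add: INFM_nat_le)
qed

lemma measurable_point [measurable]: "point \<in> borel_measurable code_measure"
proof -
  have "(\<lambda>\<omega>. \<omega> i) \<in> borel_measurable code_measure" for i
  proof (rule measurable_compose)
    show "(\<lambda>\<omega>. \<omega> i) \<in> measurable code_measure (uniform_count_measure (digits i))"
      unfolding code_measure_def by (rule measurable_component_singleton) simp
    show "(\<lambda>v. v) \<in> measurable (uniform_count_measure (digits i)) borel"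
      by (auto simp: measurable_def sets_uniform_count_measure space_uniform_count_measure)
  qed
  then show ?thesis unfolding point_def by measurable
qed

lemma sets_mu [simp, measurable_cong]: "sets mu = sets borel"
  by (simp add: mu_def)

sublocale mu: prob_space mu
  unfolding mu_def by (rule codes.prob_space_distr) simp

lemma sets_point_preimage [measurable]:
  "A \<in> sets borel \<Longrightarrow> {\<omega> \<in> codes. point \<omega> \<in> A} \<in> sets code_measure"
  using measurable_sets[OF measurable_point, of A] by (simp add: vimage_def Int_def conj_commute)

lemma measure_mu:
  assumes "A \<in> sets borel"
  shows "measure mu A = measure code_measure {\<omega> \<in> codes. point \<omega> \<in> A}"
  using assms by (simp add: mu_def measure_distr vimage_def Int_def conj_commute)

lemma set_integral_mu_le_sum:
  fixes g :: "real^'d \<Rightarrow> real"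
  assumes [measurable]: "A \<in> sets borel" "g \<in> borel_measurable borel"
    and "finite I" and B: "\<And>i. i \<in> I \<Longrightarrow> B i \<in> sets code_measure" and w: "\<And>i. i \<in> I \<Longrightarrow> 0 \<le> w i"
    and cover: "\<And>\<omega>. \<omega> \<in> codes \<Longrightarrow> point \<omega> \<in> A \<Longrightarrow> \<exists>i\<in>I. \<omega> \<in> B i \<and> g (point \<omega>) \<le> w i"
  shows "(LINT y:A|mu. g y) \<le> (\<Sum>i\<in>I. w i * measure code_measure (B i))"
proof -
  have integrable: "integrable code_measure (\<lambda>\<omega>. w i * indicat_real (B i) \<omega>)" if "i \<in> I" for i
    using B[OF that] by (intro integrable_mult_right integrable_real_indicator)
      (auto simp: codes.emeasure_eq_measure)
  have "(LINT y:A|mu. g y) = (LINT \<omega>|code_measure. indicat_real A (point \<omega>) * g (point \<omega>))"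
    unfolding set_lebesgue_integral_def mu_def by (subst integral_distr) auto
  also have "\<dots> \<le> (LINT \<omega>|code_measure. (\<Sum>i\<in>I. w i * indicat_real (B i) \<omega>))"
  proof (rule integral_mono')
    show "integrable code_measure (\<lambda>\<omega>. \<Sum>i\<in>I. w i * indicat_real (B i) \<omega>)"
      by (intro Bochner_Integration.integrable_sum integrable)
    fix \<omega> assume "\<omega> \<in> space code_measure"
    have nonneg: "0 \<le> w i * indicat_real (B i) \<omega>" if "i \<in> I" for i
      using w[OF that] by simp
    show "0 \<le> (\<Sum>i\<in>I. w i * indicat_real (B i) \<omega>)"
      by (intro sum_nonneg nonneg)
    show "indicat_real A (point \<omega>) * g (point \<omega>) \<le> (\<Sum>i\<in>I. w i * indicat_real (B i) \<omega>)"
    proof (cases "point \<omega> \<in> A")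
      case True
      then obtain i where "i \<in> I" "\<omega> \<in> B i" "g (point \<omega>) \<le> w i"
        using cover \<open>\<omega> \<in> space code_measure\<close> by auto
      then have "indicat_real A (point \<omega>) * g (point \<omega>) \<le> w i * indicat_real (B i) \<omega>"
        using True by simp
      also have "\<dots> \<le> (\<Sum>i\<in>I. w i * indicat_real (B i) \<omega>)"
        using \<open>i \<in> I\<close> \<open>finite I\<close> nonneg by (intro member_le_sum) auto
      finally show ?thesis .
    qed (auto intro!: sum_nonneg nonneg)
  qed
  also have "\<dots> = (\<Sum>i\<in>I. LINT \<omega>|code_measure. w i * indicat_real (B i) \<omega>)"
    by (rule Bochner_Integration.integral_sum) (rule integrable)
  also have "\<dots> = (\<Sum>i\<in>I. w i * measure code_measure (B i))"
    using sets.sets_into_space[OF B] by (intro sum.cong) (auto simp: Int_absorb2)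
  finally show ?thesis .
qed

lemma set_integral_mu_le:
  fixes g :: "real^'d \<Rightarrow> real"
  assumes "A \<in> sets borel" "g \<in> borel_measurable borel"
    and "\<And>\<omega>. \<omega> \<in> codes \<Longrightarrow> point \<omega> \<in> A \<Longrightarrow> g (point \<omega>) \<le> c" and "c \<ge> 0"
  shows "(LINT y:A|mu. g y) \<le> c * measure mu A"
  using set_integral_mu_le_sum[of A g "{()}" "\<lambda>_. {\<omega> \<in> codes. point \<omega> \<in> A}" "\<lambda>_. c"] assms
  by (simp add: measure_mu sets_point_preimage)

lemma spt_mu_subset: "spt mu \<subseteq> point ` codes"
proof -
  have "closed (point ` codes)"
    unfolding codes_def by (intro compact_imp_closed compact_point_image) auto
  then have "open (- (point ` codes))" by (simp add: open_Compl)
  moreover have "{\<omega> \<in> codes. point \<omega> \<in> - (point ` codes)} = {}" by auto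
  ultimately have "measure mu (- (point ` codes)) = 0"
    by (simp only: measure_mu borel_open measure_empty)
  with \<open>open (- (point ` codes))\<close> show ?thesis
    by (auto simp: spt_def mu.emeasure_eq_measure)
qed

lemma point_in_cbox: "\<omega> \<in> codes \<Longrightarrow> point \<omega> \<in> cbox 0 (\<chi> k. side 0)"
  using corner_le_point[of \<omega> 0] point_less_corner_add[of \<omega> _ 0]
  by (simp add: mem_box_cart less_imp_le)

end

section \<open>The satellite construction\<close>

lemma sum_geometric_subset_le:
  fixes c r B :: real
  assumes "finite A" "0 \<le> c" "0 \<le> r" "r < 1" "0 \<le> B" and le: "\<And>i. i \<in> A \<Longrightarrow> c * r ^ i \<le> B"
  shows "(\<Sum>i\<in>A. c * r ^ i) \<le> B / (1 - r)"
proof (cases "A = {}")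
  case False
  define m where "m = Min A"
  define M where "M = Max A"
  have "m \<in> A" "A \<subseteq> {m..M}" "m \<le> M"
    using assms(1) False by (auto simp: m_def M_def)
  have "(1 - r) * (\<Sum>i\<in>A. c * r ^ i) \<le> (1 - r) * (\<Sum>i=m..M. c * r ^ i)"
    using assms \<open>A \<subseteq> {m..M}\<close> by (intro mult_left_mono sum_mono2) auto
  also have "\<dots> = c * ((1 - r) * (\<Sum>i=m..M. r ^ i))"
    by (simp add: sum_distrib_left mult_ac)
  also have "\<dots> = c * (r ^ m - r ^ Suc M)"
    using \<open>m \<le> M\<close> by (simp only: sum_gp_multiplied)
  also have "\<dots> \<le> c * r ^ m"
    using assms by (intro mult_left_mono) auto
  also have "\<dots> \<le> B"
    using le[OF \<open>m \<in> A\<close>] .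
  finally show ?thesis
    using \<open>r < 1\<close> by (simp add: field_simps)
qed (use assms in auto)

lemma four_power_eq: "(4::'a::comm_semiring_1) ^ m = 2 ^ m * 2 ^ m"
  by (simp flip: power_mult_distrib)

text \<open>
  The squares of generation \<open>n\<close> have the parameter \<open>b + n\<close>. Row \<open>0\<close> is the centre row, rows
  \<open>1, \<dots>, satellites n\<close> are the satellites, and \<open>gap n i\<close> is the distance between adjacent squares
  of the next generation in row \<open>i\<close>. Every length is a power of \<open>1/2\<close> and is given by its exponent,
  so that all squares are dyadic.
\<close>

locale satellite_cantor =
  fixes b :: nat
begin

definition satellites :: "nat \<Rightarrow> nat" where
  "satellites n = 4 ^ (b + n)"

primrec side_exp :: "nat \<Rightarrow> nat" where
  "side_exp 0 = b + 1"
| "side_exp (Suc n) = side_exp n + 2 * satellites n + 2 * (b + n) + 3"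

declare side_exp.simps(2) [simp del]

definition side :: "nat \<Rightarrow> real" where
  "side n = (1/2) ^ side_exp n"

definition row_height :: "nat \<Rightarrow> nat \<Rightarrow> real" where
  "row_height n i = (if i = 0 then 0 else (1/2) ^ (side_exp n + 2 * i))"

definition gap_exp :: "nat \<Rightarrow> nat \<Rightarrow> nat" where
  "gap_exp n i = side_exp n + 2 * satellites n + 1 + (if i = 0 then 2 * (b + n) else 0)"

definition gap :: "nat \<Rightarrow> nat \<Rightarrow> real" where
  "gap n i = (1/2) ^ gap_exp n i"

definition row_card :: "nat \<Rightarrow> nat \<Rightarrow> nat" where
  "row_card n i = 2 ^ (gap_exp n i - side_exp n)"

definition digit :: "nat \<Rightarrow> nat \<Rightarrow> nat \<Rightarrow> real^2" where
  "digit n i p = vector [gap n i * real p, row_height n i]"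

definition row_digits :: "nat \<Rightarrow> nat \<Rightarrow> (real^2) set" where
  "row_digits n i = digit n i ` {..<row_card n i}"

definition digits :: "nat \<Rightarrow> (real^2) set" where
  "digits n = (\<Union>i\<le>satellites n. row_digits n i)"

lemma satellites_pos [simp]: "0 < satellites n"
  by (simp add: satellites_def)

lemma side_pos [simp]: "0 < side n"
  by (simp add: side_def)

lemma gap_pos [simp]: "0 < gap n i"
  by (simp add: gap_def)

lemma gap_eq: "gap n i = (if i = 0 then 4 else 4 * 4 ^ (b + n)) * side (Suc n)"
  by (simp add: gap_def gap_exp_def side_def side_exp.simps(2) power_add power_mult power_one_over)

lemma gap_ge: "4 * side (Suc n) \<le> gap n i"
  by (simp add: gap_eq less_imp_le)

lemma gap_mult_row_card: "gap n i * real (row_card n i) = side n"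
proof -
  have "(2::real) ^ side_exp n * 2 ^ (gap_exp n i - side_exp n) = 2 ^ gap_exp n i"
    by (simp add: gap_exp_def flip: power_add)
  then show ?thesis
    by (simp add: gap_def row_card_def side_def power_one_over field_simps)
qed

lemma row_height_0 [simp]: "row_height n 0 = 0"
  by (simp add: row_height_def)

lemma row_height_pos: "0 < i \<Longrightarrow> 0 < row_height n i"
  by (simp add: row_height_def)

lemma row_height_nonneg: "0 \<le> row_height n i"
  by (simp add: row_height_def)

lemma row_height_le: "row_height n i \<le> side n / 4"
proof (cases "i = 0")
  case False
  then have "(1/2::real) ^ (side_exp n + 2 * i) \<le> (1/2) ^ (side_exp n + 2)"
    by (intro power_decreasing) auto
  then show ?thesis
    using False by (simp add: row_height_def side_def power_add power2_eq_square)
qed (simp add: less_imp_le)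

lemma row_height_antimono: "0 < i \<Longrightarrow> i \<le> k \<Longrightarrow> row_height n k \<le> row_height n i"
  by (auto simp: row_height_def intro!: power_decreasing)

lemma row_height_less: "0 < i \<Longrightarrow> i < k \<Longrightarrow> 4 * row_height n k \<le> row_height n i"
  using power_decreasing[of "side_exp n + 2 * i + 2" "side_exp n + 2 * k" "1/2::real"]
  by (simp add: row_height_def power_add)

lemma row_height_satellites: "row_height n (satellites n) = 8 * 4 ^ (b + n) * side (Suc n)"
  by (simp add: row_height_def side_def side_exp.simps(2) power_add power_mult power_one_over)

lemma side_Suc_le_row_height:
  assumes "0 < i" "i \<le> satellites n"
  shows "8 * side (Suc n) \<le> row_height n i"
proof -
  have "8 * side (Suc n) \<le> row_height n (satellites n)"
    by (simp add: row_height_satellites less_imp_le)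
  also have "\<dots> \<le> row_height n i"
    using assms by (rule row_height_antimono)
  finally show ?thesis .
qed

lemma row_height_isolated:
  assumes "k \<noteq> i" "k \<le> satellites n" "i \<le> satellites n"
    and d: "d = row_height n (if i = 0 then satellites n else i)"
  shows "row_height n k + side (Suc n) \<le> row_height n i - d / 2
    \<or> row_height n i + d \<le> row_height n k"
proof -
  consider "i = 0" "0 < k" | "0 < i" "k = 0" | "0 < i" "0 < k" "k < i" | "0 < i" "i < k"
    using assms(1) by linarith
  then show ?thesis
  proof cases
    case 1
    then show ?thesis using row_height_antimono[of k "satellites n" n] assms by simp
  next
    case 2
    then have "8 * side (Suc n) \<le> row_height n i"
      using assms by (intro side_Suc_le_row_height)
    then show ?thesis using 2 d side_pos[of "Suc n"] by (simp del: side_pos)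
  next
    case 3
    then show ?thesis using row_height_less[of k i n] row_height_pos[of i n] d by simp
  next
    case 4
    then have "8 * side (Suc n) \<le> row_height n i" "4 * row_height n k \<le> row_height n i"
      using assms by (auto intro: side_Suc_le_row_height row_height_less)
    then show ?thesis using 4 d row_height_pos[of i n] by simp
  qed
qed

lemma row_height_separated:
  assumes "i \<noteq> k" "i \<le> satellites n" "k \<le> satellites n"
  shows "4 * side (Suc n) \<le> \<bar>row_height n i - row_height n k\<bar>"
proof -
  have "8 * side (Suc n) \<le> row_height n (if i = 0 then satellites n else i)"
    using assms by (auto intro: side_Suc_le_row_height)
  then show ?thesis
    using row_height_isolated[OF assms(1)[symmetric] assms(3,2) refl] side_pos[of "Suc n"]
    by linarith
qed

lemma digit_nth [simp]: "digit n i p $ 1 = gap n i * real p" "digit n i p $ 2 = row_height n i"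
  by (simp_all add: digit_def)

lemma inj_digit: "inj (digit n i)"
  by (rule injI) (simp add: vec_eq_iff forall_2 less_imp_neq[OF gap_pos, symmetric])

lemma row_digitsE:
  assumes "v \<in> row_digits n i"
  obtains p where "p < row_card n i" "v $ 1 = gap n i * real p" "v $ 2 = row_height n i"
  using assms by (auto simp: row_digits_def)

lemma row_digits_nth_2: "v \<in> row_digits n i \<Longrightarrow> v $ 2 = row_height n i"
  by (auto elim: row_digitsE)

lemma digitsE:
  assumes "v \<in> digits n"
  obtains i where "i \<le> satellites n" "v \<in> row_digits n i"
  using assms by (auto simp: digits_def)

lemma row_digits_subset: "i \<le> satellites n \<Longrightarrow> row_digits n i \<subseteq> digits n"
  by (auto simp: digits_def)

lemma card_row_digits: "card (row_digits n i) = row_card n i"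
  unfolding row_digits_def by (simp add: card_image inj_on_subset[OF inj_digit])

lemma disjoint_row_digits:
  assumes "i \<le> satellites n" "k \<le> satellites n" "i \<noteq> k"
  shows "row_digits n i \<inter> row_digits n k = {}"
proof -
  have "row_height n i \<noteq> row_height n k"
    using row_height_separated[OF assms(3,1,2)] side_pos[of "Suc n"]
    by (intro notI) linarith
  then show ?thesis
    by (auto dest!: row_digits_nth_2)
qed

lemma card_digits: "card (digits n) = 2 * row_card n 0"
proof -
  have "card (digits n) = (\<Sum>i\<le>satellites n. row_card n i)"
    unfolding digits_def using disjoint_row_digits
    by (subst card_UN_disjoint) (auto simp: card_row_digits, simp add: row_digits_def)
  also have "\<dots> = row_card n 0 + (\<Sum>i\<in>{1..satellites n}. row_card n i)"
    by (simp add: sum.atLeast1_atMost_eq sum.atMost_shift lessThan_Suc_atMost)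
  also have "(\<Sum>i\<in>{1..satellites n}. row_card n i)
      = (\<Sum>i\<in>{1..satellites n}. 2 ^ (2 * satellites n + 1))"
    by (intro sum.cong) (auto simp: row_card_def gap_exp_def)
  also have "\<dots> = row_card n 0"
    by (simp add: row_card_def gap_exp_def power_add power_mult)
      (simp add: satellites_def power_add)
  finally show ?thesis by simp
qed

lemma digit_bounds:
  assumes "v \<in> digits n"
  shows "0 \<le> v $ k \<and> v $ k + 2 * side (Suc n) \<le> side n"
proof -
  obtain i where i: "i \<le> satellites n" "v \<in> row_digits n i"
    using assms by (rule digitsE)
  obtain p where p: "p < row_card n i" "v $ 1 = gap n i * real p" "v $ 2 = row_height n i"
    using i(2) by (rule row_digitsE)
  have "gap n i * (real p + 1) \<le> gap n i * real (row_card n i)"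
    using p by (intro mult_left_mono) (auto simp: less_imp_le)
  then have "0 \<le> v $ 1 \<and> v $ 1 + 2 * side (Suc n) \<le> side n"
    using gap_ge[of n i] side_pos[of "Suc n"]
    by (simp add: p gap_mult_row_card distrib_left less_imp_le del: side_pos)
  moreover have "8 * side (Suc n) \<le> side n / 4"
    using side_Suc_le_row_height[of 1 n] row_height_le[of n 1] satellites_pos[of n] by linarith
  then have "0 \<le> v $ 2 \<and> v $ 2 + 2 * side (Suc n) \<le> side n"
    using row_height_le[of n i] row_height_nonneg[of n i] side_pos[of n] side_pos[of "Suc n"]
    unfolding p by linarith
  ultimately show ?thesis
    using exhaust_2[of k] by auto
qed

lemma digits_apart:
  assumes "v \<in> digits n" "w \<in> digits n" "v \<noteq> w"
  shows "\<exists>k. 2 * side (Suc n) \<le> \<bar>v $ k - w $ k\<bar>"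
proof -
  obtain i k where i: "i \<le> satellites n" "v \<in> row_digits n i"
    and k: "k \<le> satellites n" "w \<in> row_digits n k"
    using assms by (auto elim!: digitsE)
  show ?thesis
  proof (cases "i = k")
    case True
    obtain p q where p: "v $ 1 = gap n i * real p" and q: "w $ 1 = gap n i * real q"
      using i k True by (auto elim!: row_digitsE)
    moreover have "v $ 2 = w $ 2"
      using i k True by (simp add: row_digits_nth_2)
    ultimately have "p \<noteq> q"
      using \<open>v \<noteq> w\<close> by (auto simp: vec_eq_iff forall_2)
    then have "1 \<le> \<bar>real p - real q\<bar>" by linarith
    then have "gap n i * 1 \<le> gap n i * \<bar>real p - real q\<bar>"
      by (intro mult_left_mono) (auto simp: less_imp_le)
    also have "\<dots> = \<bar>v $ 1 - w $ 1\<bar>"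
      by (simp add: p q abs_mult less_imp_le flip: right_diff_distrib)
    finally show ?thesis
      using gap_ge[of n i] side_pos[of "Suc n"] by (intro exI[of _ 1]) linarith
  next
    case False
    then have "4 * side (Suc n) \<le> \<bar>v $ 2 - w $ 2\<bar>"
      using i k by (simp add: row_digits_nth_2 row_height_separated)
    then show ?thesis
      using side_pos[of "Suc n"] by (intro exI[of _ 2]) linarith
  qed
qed

sublocale cantor_scheme digits side
proof
  fix n v w k
  show "finite (digits n)"
    by (simp add: digits_def row_digits_def)
  show "digits n \<noteq> {}"
    using card_digits[of n] by (auto simp: row_card_def)
  show "v \<in> digits n \<Longrightarrow> 0 \<le> v $ k" "v \<in> digits n \<Longrightarrow> v $ k + 2 * side (Suc n) \<le> side n"
    using digit_bounds by blast+
qed (simp, rule digits_apart)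

definition row_density :: "nat \<Rightarrow> nat \<Rightarrow> real" where
  "row_density n i = (if i = 0 then 2 ^ (b + n) else (1/2) ^ (b + n))"

lemma mass_eq: "mass n = 2 ^ (b + n + 1) * side n"
proof (induction n)
  case 0
  show ?case by (simp add: mass_def side_def power_one_over)
next
  case (Suc n)
  have "mass (Suc n) = mass n / (2 * real (row_card n 0))"
    by (simp add: mass_def card_digits)
  also have "\<dots> = 2 ^ (b + n) * gap n 0"
    by (simp add: Suc gap_mult_row_card[symmetric, of n 0]) (simp add: row_card_def)
  finally show ?case by (simp add: gap_eq)
qed

lemma mass_Suc_eq_density: "mass (Suc n) = row_density n i * gap n i"
  by (simp add: mass_eq row_density_def gap_eq four_power_eq power_one_over)

lemma dyadic_digit:
  assumes "v \<in> digits n"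
  shows "dyadic (side_exp (Suc n)) (v $ k)"
proof -
  obtain i where i: "i \<le> satellites n" "v \<in> row_digits n i"
    using assms by (rule digitsE)
  obtain p where p: "v $ 1 = gap n i * real p" "v $ 2 = row_height n i"
    using i(2) by (rule row_digitsE)
  have "dyadic (side_exp (Suc n)) (v $ 1)"
    unfolding p gap_def
    by (intro dyadic_mult_of_nat dyadic_power) (simp add: gap_exp_def side_exp.simps(2))
  moreover have "dyadic (side_exp (Suc n)) (v $ 2)"
    unfolding p row_height_def using i by (auto simp: side_exp.simps(2) intro: dyadic_power)
  ultimately show ?thesis
    using exhaust_2[of k] by auto
qed

lemma le_side_exp: "n \<le> side_exp n"
  by (induction n) (auto simp: side_exp.simps(2))

lemma side_exp_mono: "n \<le> m \<Longrightarrow> side_exp n \<le> side_exp m"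
  by (rule lift_Suc_mono_le) (auto simp: side_exp.simps(2))

lemma dyadic_corner: "\<omega> \<in> codes \<Longrightarrow> dyadic (side_exp n) (corner n \<omega> $ k)"
proof (induction n)
  case (Suc n)
  have "dyadic (side_exp (Suc n)) (corner n \<omega> $ k)"
    by (rule dyadic_mono[OF Suc.IH[OF Suc.prems]]) (simp add: side_exp_mono)
  then show ?case
    using dyadic_digit[OF codesD[OF Suc.prems]] by (simp add: corner_Suc dyadic_add)
qed simp

lemma dyadic_floor_point:
  assumes "\<omega> \<in> codes"
  shows "dyadic_floor (side_exp n) (point \<omega> $ k) = corner n \<omega> $ k"
  using dyadic_corner[OF assms] corner_le_point[OF assms] point_less_corner_add[OF assms]
  by (intro dyadic_floor_eqI) (auto simp: side_def)

lemma dyadic_le_point_iff: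
  assumes "\<omega> \<in> codes" "dyadic (side_exp n) u"
  shows "u \<le> point \<omega> $ k \<longleftrightarrow> u \<le> corner n \<omega> $ k"
  using dyadic_le_dyadic_floor_iff[OF assms(2)] dyadic_floor_point[OF assms(1)] by metis

definition strip :: "(nat \<Rightarrow> real^2) \<Rightarrow> nat \<Rightarrow> nat \<Rightarrow> real \<Rightarrow> real \<Rightarrow> (nat \<Rightarrow> real^2) set" where
  "strip \<xi> n i u w =
     branches \<xi> n {v \<in> row_digits n i. u \<le> corner n \<xi> $ 1 + v $ 1 \<and> corner n \<xi> $ 1 + v $ 1 < w}"

lemma sets_strip: "\<xi> \<in> codes \<Longrightarrow> i \<le> satellites n \<Longrightarrow> strip \<xi> n i u w \<in> sets code_measure"
  unfolding strip_def using row_digits_subset[of i n] by (intro sets_branches) auto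

lemma measure_strip:
  assumes \<xi>: "\<xi> \<in> codes" and i: "i \<le> satellites n"
  defines "c \<equiv> corner n \<xi> $ 1"
  shows "measure code_measure (strip \<xi> n i (c + gap n i * of_int y) (c + gap n i * of_int z))
    = row_density n i * gap n i * real (card ({nat y..<nat z} \<inter> {..<row_card n i}))"
proof -
  define T where "T = {v \<in> row_digits n i.
    c + gap n i * of_int y \<le> c + v $ 1 \<and> c + v $ 1 < c + gap n i * of_int z}"
  have "T = digit n i ` ({p. gap n i * of_int y \<le> gap n i * real p \<and>
      gap n i * real p < gap n i * of_int z} \<inter> {..<row_card n i})"
    by (auto simp: T_def row_digits_def)
  then have "card T = card ({nat y..<nat z} \<inter> {..<row_card n i})"
    unfolding multiples_in_interval_eq[OF gap_pos]
    by (simp add: card_image inj_on_subset[OF inj_digit])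
  moreover have "T \<subseteq> digits n"
    using row_digits_subset[OF i] by (auto simp: T_def)
  ultimately show ?thesis
    using measure_branches[OF \<xi>, of T n] mass_Suc_eq_density[of n i]
    by (simp add: strip_def T_def c_def)
qed

lemma dyadic_eq_corner_add_gap:
  assumes "\<xi> \<in> codes" "dyadic (gap_exp n i) u"
  obtains y :: int where "u = corner n \<xi> $ 1 + gap n i * of_int y"
proof -
  have "dyadic (gap_exp n i) (corner n \<xi> $ 1)"
    using dyadic_corner[OF assms(1)] by (rule dyadic_mono) (simp add: gap_exp_def)
  then obtain y where "(u - corner n \<xi> $ 1) * 2 ^ gap_exp n i = of_int y"
    using dyadic_diff[OF assms(2)] by (meson Ints_cases dyadic_def)
  then show ?thesis
    by (intro that[of y]) (simp add: gap_def power_one_over field_simps)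
qed

lemma
  assumes \<xi>: "\<xi> \<in> codes" and i: "i \<le> satellites n"
    and u: "dyadic (gap_exp n i) u" and w: "dyadic (gap_exp n i) w" and "u \<le> w"
  shows measure_strip_le: "measure code_measure (strip \<xi> n i u w) \<le> (w - u) * row_density n i"
    and measure_strip_eq: "corner n \<xi> $ 1 \<le> u \<Longrightarrow> w \<le> corner n \<xi> $ 1 + side n \<Longrightarrow>
      measure code_measure (strip \<xi> n i u w) = (w - u) * row_density n i"
proof -
  obtain y z :: int where y: "u = corner n \<xi> $ 1 + gap n i * of_int y"
    and z: "w = corner n \<xi> $ 1 + gap n i * of_int z"
    using dyadic_eq_corner_add_gap[OF \<xi> u] dyadic_eq_corner_add_gap[OF \<xi> w] by metis
  have "y \<le> z"
    using \<open>u \<le> w\<close> by (simp add: y z)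
  define m where "m = card ({nat y..<nat z} \<inter> {..<row_card n i})"
  have measure: "measure code_measure (strip \<xi> n i u w) = row_density n i * gap n i * real m"
    unfolding y z m_def by (rule measure_strip[OF \<xi> i])
  have length: "(w - u) * row_density n i = row_density n i * gap n i * real_of_int (z - y)"
    by (simp add: y z algebra_simps)
  have "m \<le> card {nat y..<nat z}"
    unfolding m_def by (intro card_mono) auto
  then have "real m \<le> real_of_int (z - y)"
    using \<open>y \<le> z\<close> by simp
  then show "measure code_measure (strip \<xi> n i u w) \<le> (w - u) * row_density n i"
    unfolding measure length by (intro mult_left_mono) (auto simp: row_density_def less_imp_le)
  assume "corner n \<xi> $ 1 \<le> u" "w \<le> corner n \<xi> $ 1 + side n"
  then have "0 \<le> y" "gap n i * of_int z \<le> gap n i * real (row_card n i)"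
    using gap_pos[of n i] by (simp_all add: y z gap_mult_row_card zero_le_mult_iff)
  then have "z \<le> int (row_card n i)"
    using gap_pos[of n i] by simp
  then have "{nat y..<nat z} \<inter> {..<row_card n i} = {nat y..<nat z}"
    by auto
  then show "measure code_measure (strip \<xi> n i u w) = (w - u) * row_density n i"
    unfolding measure length m_def using \<open>0 \<le> y\<close> \<open>y \<le> z\<close> by simp
qed

lemma sum_row_height_sq_le:
  assumes "0 \<le> B"
  shows "(\<Sum>i | 0 < i \<and> i \<le> satellites n \<and> row_height n i < B. (row_height n i)\<^sup>2) \<le> 16/15 * B\<^sup>2"
proof -
  define I where "I = {i. 0 < i \<and> i \<le> satellites n \<and> row_height n i < B}"
  have sq: "(row_height n i)\<^sup>2 = (side n)\<^sup>2 * (1/16) ^ i" if "i \<in> I" for i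
  proof -
    have "row_height n i = side n * (1/4) ^ i"
      using that by (simp add: I_def row_height_def side_def power_add power_mult power2_eq_square)
    moreover have "((1/4::real) ^ i)\<^sup>2 = (1/16) ^ i"
      by (simp add: power2_eq_square flip: power_mult_distrib)
    ultimately show ?thesis by (simp add: power_mult_distrib)
  qed
  have "(\<Sum>i\<in>I. (row_height n i)\<^sup>2) = (\<Sum>i\<in>I. (side n)\<^sup>2 * (1/16) ^ i)"
    by (intro sum.cong refl sq)
  also have "\<dots> \<le> B\<^sup>2 / (1 - 1/16)"
  proof (rule sum_geometric_subset_le)
    show "(side n)\<^sup>2 * (1/16) ^ i \<le> B\<^sup>2" if "i \<in> I" for i
      unfolding sq[OF that, symmetric]
      using that row_height_nonneg[of n i] by (intro power_mono) (auto simp: I_def)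
  qed (auto simp: I_def)
  finally show ?thesis by (simp add: I_def)
qed

lemma dyadic_floor_row_height:
  "dyadic_floor j (row_height n i) = (if side_exp n + 2 * i \<le> j then row_height n i else 0)"
  by (auto simp: row_height_def dyadic_floor_power dyadic_floor_of_dyadic)

definition isolation_exp :: "nat \<Rightarrow> nat \<Rightarrow> nat" where
  "isolation_exp n i = side_exp n + 2 * (if i = 0 then satellites n else i)"

lemma isolation_exp_le: "i \<le> satellites n \<Longrightarrow> isolation_exp n i \<le> side_exp n + 2 * satellites n"
  by (simp add: isolation_exp_def)

lemma isolation_exp_less_gap_exp: "i \<le> satellites n \<Longrightarrow> isolation_exp n i < gap_exp n i"
  by (simp add: isolation_exp_def gap_exp_def)

lemma power_isolation_exp:
  "(1/2) ^ isolation_exp n i = row_height n (if i = 0 then satellites n else i)"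
  by (simp add: isolation_exp_def row_height_def)

section \<open>The squares at one scale\<close>

text \<open>
  \<open>Q\<close> is the dyadic square of side \<open>l\<close> around a point of the Cantor set, and the scale \<open>l\<close> lies
  between the side lengths of the generations \<open>n\<close> and \<open>n + 1\<close>. The lower left corners of \<open>Q\<close> (the
  base) and of the square of generation \<open>n\<close> (the parent) are \<open>a\<close> and \<open>c\<close>.
\<close>

context
  fixes \<xi> :: "nat \<Rightarrow> real^2" and n j :: nat and l :: real and Q :: "(real^2) set" and a c :: "real^2"
  assumes \<xi>: "\<xi> \<in> codes" and j: "side_exp n < j" "j \<le> side_exp (Suc n)"
  defines "l \<equiv> (1/2) ^ j" and "Q \<equiv> dyadic_square_at j (point \<xi>)"
    and "a \<equiv> \<chi> k. dyadic_floor j (point \<xi> $ k)" and "c \<equiv> corner n \<xi>"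
begin

lemma scale_pos: "0 < l"
  by (simp add: l_def)

lemma double_scale_le_side: "2 * l \<le> side n"
  using power_decreasing[of "Suc (side_exp n)" j "1/2::real"] j by (simp add: l_def side_def)

lemma side_Suc_le_scale: "side (Suc n) \<le> l"
  unfolding l_def side_def using j by (intro power_decreasing) auto

lemma dyadic_scale: "dyadic j l"
  unfolding l_def by (rule dyadic_power) simp

lemma dyadic_base: "dyadic j (a $ k)"
  by (simp add: a_def dyadic_dyadic_floor)

lemma dyadic_parent: "dyadic j (c $ k)"
  unfolding c_def using dyadic_corner[OF \<xi>] less_imp_le[OF j(1)] by (rule dyadic_mono)

lemma dyadic_fine: "dyadic j u \<Longrightarrow> dyadic (side_exp (Suc n)) u"
  using j(2) by (rule dyadic_mono[rotated])

lemma square_eq: "Q = half_open_square a l"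
  by (simp add: Q_def dyadic_square_at_def a_def l_def)

lemma mem_square_iff: "y \<in> Q \<longleftrightarrow> (\<forall>k. a $ k \<le> y $ k \<and> y $ k < a $ k + l)"
  by (simp add: square_eq half_open_square_def)

lemma mem_triple_square_iff: "y \<in> triple Q \<longleftrightarrow> (\<forall>k. a $ k - l \<le> y $ k \<and> y $ k < a $ k + 2 * l)"
  by (simp add: Q_def a_def l_def mem_triple_dyadic_square_at_iff)

lemma square_borel: "Q \<in> sets borel" "triple Q \<in> sets borel"
  by (simp_all add: Q_def)

lemma point_mem_square: "point \<xi> \<in> Q"
  by (simp add: Q_def mem_dyadic_square_at_iff)

lemma parent_le_base: "c $ k \<le> a $ k"
  using dyadic_parent[of k] corner_le_point[OF \<xi>]
  by (simp add: a_def c_def dyadic_le_dyadic_floor_iff)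

lemma base_add_scale_le: "a $ k + l \<le> c $ k + side n"
proof -
  have "a $ k \<le> point \<xi> $ k"
    using point_mem_square by (simp add: mem_square_iff)
  then have "a $ k < c $ k + side n"
    using point_less_corner_add[OF \<xi>, of k n] by (simp add: c_def)
  moreover have "dyadic j (c $ k + side n)"
    using j by (intro dyadic_add dyadic_parent) (auto simp: side_def intro: dyadic_power)
  ultimately show ?thesis
    unfolding l_def by (intro dyadic_less_imp_add_le dyadic_base)
qed

lemma same_prefix:
  assumes "\<omega> \<in> codes" "point \<omega> \<in> triple Q" "i < n"
  shows "\<omega> i = \<xi> i"
proof (rule ccontr)
  assume "\<omega> i \<noteq> \<xi> i"
  then obtain k where k: "side n \<le> \<bar>point \<omega> $ k - point \<xi> $ k\<bar>"
    using points_separated[OF assms(1) \<xi> assms(3)] by blast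
  moreover have "a $ k - l \<le> point \<omega> $ k" "point \<omega> $ k < a $ k + 2 * l"
    using assms(2) by (auto simp: mem_triple_square_iff)
  moreover have "a $ k \<le> point \<xi> $ k" "point \<xi> $ k < a $ k + l"
    using point_mem_square by (auto simp: mem_square_iff)
  ultimately show False
    using double_scale_le_side by linarith
qed

lemma corner_Suc_of_same_prefix:
  "(\<And>i. i < n \<Longrightarrow> \<omega> i = \<xi> i) \<Longrightarrow> corner (Suc n) \<omega> $ k = c $ k + \<omega> n $ k"
  by (simp add: corner_Suc c_def corner_cong[of n \<omega> \<xi>])

lemma point_in_row_bounds:
  assumes "\<omega> \<in> codes" "\<And>i. i < n \<Longrightarrow> \<omega> i = \<xi> i" "\<omega> n \<in> row_digits n i"
  shows "c $ 2 + row_height n i \<le> point \<omega> $ 2" "point \<omega> $ 2 < c $ 2 + row_height n i + side (Suc n)"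
  using corner_le_point[OF assms(1), of "Suc n" 2] point_less_corner_add[OF assms(1), of 2 "Suc n"]
    corner_Suc_of_same_prefix[OF assms(2)] row_digits_nth_2[OF assms(3)] by auto

lemma base_2_eq:
  assumes "\<xi> n \<in> row_digits n i"
  shows "a $ 2 = c $ 2 + (if side_exp n + 2 * i \<le> j then row_height n i else 0)"
proof -
  have "a $ 2 = dyadic_floor j (corner (Suc n) \<xi> $ 2)"
    by (simp add: a_def dyadic_floor_dyadic_floor[OF j(2)] flip: dyadic_floor_point[OF \<xi>])
  also have "\<dots> = dyadic_floor j (c $ 2 + row_height n i)"
    by (simp add: corner_Suc_of_same_prefix row_digits_nth_2[OF assms])
  also have "\<dots> = c $ 2 + dyadic_floor j (row_height n i)"
    by (rule dyadic_floor_add[OF dyadic_parent])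
  finally show ?thesis
    by (simp add: dyadic_floor_row_height)
qed

lemma code_in_strip:
  assumes "\<omega> \<in> codes" "point \<omega> \<in> triple Q" "\<omega> n \<in> row_digits n i"
  shows "\<omega> \<in> strip \<xi> n i (a $ 1 - l) (a $ 1 + 2 * l)"
proof -
  note prefix = same_prefix[OF assms(1,2)]
  have "a $ 1 - l \<le> point \<omega> $ 1" "point \<omega> $ 1 < a $ 1 + 2 * l"
    using assms(2) by (auto simp: mem_triple_square_iff)
  moreover have "dyadic (side_exp (Suc n)) (a $ 1 - l)"
    by (intro dyadic_fine dyadic_diff dyadic_base dyadic_scale)
  ultimately have "a $ 1 - l \<le> corner (Suc n) \<omega> $ 1" "corner (Suc n) \<omega> $ 1 < a $ 1 + 2 * l"
    using dyadic_le_point_iff[OF assms(1)] corner_le_point[OF assms(1), of "Suc n" 1] by auto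
  then show ?thesis
    using assms prefix corner_Suc_of_same_prefix[OF prefix]
    by (auto simp: strip_def branches_def c_def)
qed

lemma measure_triple_strip_le:
  assumes "i \<le> satellites n" "j \<le> gap_exp n i"
  shows "measure code_measure (strip \<xi> n i (a $ 1 - l) (a $ 1 + 2 * l)) \<le> 3 * l * row_density n i"
proof -
  have "dyadic (gap_exp n i) u" if "dyadic j u" for u
    using that assms(2) by (rule dyadic_mono)
  then have "dyadic (gap_exp n i) (a $ 1 - l)" "dyadic (gap_exp n i) (a $ 1 + l + l)"
    by (blast intro: dyadic_diff dyadic_add dyadic_base dyadic_scale)+
  then show ?thesis
    using measure_strip_le[OF \<xi> assms(1), of "a $ 1 - l" "a $ 1 + 2 * l"] scale_pos
    by (simp add: add.assoc)
qed

lemma measure_ge_row: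
  assumes i: "i \<le> satellites n" "j \<le> gap_exp n i" and B: "B \<in> sets borel"
    and sub: "\<And>y. a $ 1 \<le> y $ 1 \<Longrightarrow> y $ 1 < a $ 1 + l \<Longrightarrow> c $ 2 + row_height n i \<le> y $ 2 \<Longrightarrow>
      y $ 2 < c $ 2 + row_height n i + side (Suc n) \<Longrightarrow> y \<in> B"
  shows "l * row_density n i \<le> measure mu B"
proof -
  have "dyadic (gap_exp n i) u" if "dyadic j u" for u
    using that i(2) by (rule dyadic_mono)
  then have "dyadic (gap_exp n i) (a $ 1)" "dyadic (gap_exp n i) (a $ 1 + l)"
    by (blast intro: dyadic_add dyadic_base dyadic_scale)+
  then have "l * row_density n i = measure code_measure (strip \<xi> n i (a $ 1) (a $ 1 + l))"
    using measure_strip_eq[OF \<xi> i(1), of "a $ 1" "a $ 1 + l"] scale_pos parent_le_base[of 1]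
      base_add_scale_le[of 1]
    by (simp add: c_def)
  also have "\<dots> \<le> measure code_measure {\<omega> \<in> codes. point \<omega> \<in> B}"
  proof (intro codes.finite_measure_mono sets_point_preimage B subsetI)
    fix \<omega> assume \<omega>: "\<omega> \<in> strip \<xi> n i (a $ 1) (a $ 1 + l)"
    then have "\<omega> \<in> codes" and prefix: "\<And>i. i < n \<Longrightarrow> \<omega> i = \<xi> i" and "\<omega> n \<in> row_digits n i"
      by (auto simp: strip_def branches_def)
    have "a $ 1 \<le> corner (Suc n) \<omega> $ 1" "corner (Suc n) \<omega> $ 1 < a $ 1 + l"
      using \<omega> corner_Suc_of_same_prefix[OF prefix] by (auto simp: strip_def branches_def c_def)
    moreover have "dyadic (side_exp (Suc n)) (a $ 1 + l)"
      by (intro dyadic_fine dyadic_add dyadic_base dyadic_scale)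
    ultimately have "a $ 1 \<le> point \<omega> $ 1" "point \<omega> $ 1 < a $ 1 + l"
      using dyadic_le_point_iff[OF \<open>\<omega> \<in> codes\<close>, of "Suc n" _ 1]
        corner_le_point[OF \<open>\<omega> \<in> codes\<close>, of "Suc n" 1]
      by (auto simp: not_le[symmetric])
    then show "\<omega> \<in> {\<omega> \<in> codes. point \<omega> \<in> B}"
      using sub point_in_row_bounds[OF \<open>\<omega> \<in> codes\<close> prefix \<open>\<omega> n \<in> row_digits n i\<close>] \<open>\<omega> \<in> codes\<close>
      by auto
  qed
  also have "\<dots> = measure mu B"
    by (rule measure_mu[OF B, symmetric])
  finally show ?thesis .
qed

lemma measure_square_ge_mass: "mass (Suc n) \<le> measure mu Q"
proof -
  have digit: "{\<xi> n} \<subseteq> digits n" using codesD[OF \<xi>] by simp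
  have "mass (Suc n) = measure code_measure (branches \<xi> n {\<xi> n})"
    by (simp add: measure_branches[OF \<xi> digit])
  also have "\<dots> \<le> measure code_measure {\<omega> \<in> codes. point \<omega> \<in> Q}"
  proof (intro codes.finite_measure_mono sets_point_preimage square_borel subsetI)
    fix \<omega> assume \<omega>: "\<omega> \<in> branches \<xi> n {\<xi> n}"
    then have "corner (Suc n) \<omega> = corner (Suc n) \<xi>"
      by (intro corner_cong) (auto simp: branches_def less_Suc_eq)
    moreover have "dyadic_floor j (point \<eta> $ k) = dyadic_floor j (corner (Suc n) \<eta> $ k)"
      if "\<eta> \<in> codes" for \<eta> k
      by (simp add: dyadic_floor_dyadic_floor[OF j(2)] flip: dyadic_floor_point[OF that])
    ultimately show "\<omega> \<in> {\<omega> \<in> codes. point \<omega> \<in> Q}"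
      using \<omega> \<xi> by (simp add: Q_def mem_dyadic_square_at_iff branches_def)
  qed
  also have "\<dots> = measure mu Q"
    by (rule measure_mu[OF square_borel(1), symmetric])
  finally show ?thesis .
qed

lemma second_moment_le_row_sum:
  assumes "j \<le> side_exp n + 2 * satellites n" "a $ 2 \<le> c $ 2 + l"
  shows "(LINT y:triple Q|mu. (y $ 2 - c $ 2)\<^sup>2)
    \<le> (\<Sum>i | i \<le> satellites n \<and> row_height n i < 3 * l.
         (row_height n i + side (Suc n))\<^sup>2 * (3 * l * row_density n i))"
proof -
  define I where "I = {i. i \<le> satellites n \<and> row_height n i < 3 * l}"
  define S where "S i = strip \<xi> n i (a $ 1 - l) (a $ 1 + 2 * l)" for i
  have "(LINT y:triple Q|mu. (y $ 2 - c $ 2)\<^sup>2)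
      \<le> (\<Sum>i\<in>I. (row_height n i + side (Suc n))\<^sup>2 * measure code_measure (S i))"
  proof (rule set_integral_mu_le_sum[OF square_borel(2)])
    show "finite I" by (simp add: I_def)
    show "S i \<in> sets code_measure" if "i \<in> I" for i
      unfolding S_def using that by (intro sets_strip \<xi>) (simp add: I_def)
    fix \<omega> assume \<omega>: "\<omega> \<in> codes" "point \<omega> \<in> triple Q"
    obtain i where i: "i \<le> satellites n" "\<omega> n \<in> row_digits n i"
      using codesD[OF \<omega>(1), of n] by (rule digitsE)
    note bounds = point_in_row_bounds[OF \<omega>(1) same_prefix[OF \<omega>] i(2)]
    have "row_height n i < 3 * l"
      using bounds(1) \<omega>(2) assms(2) by (auto simp: mem_triple_square_iff dest!: spec[of _ 2])
    moreover have "(point \<omega> $ 2 - c $ 2)\<^sup>2 \<le> (row_height n i + side (Suc n))\<^sup>2"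
      using bounds row_height_nonneg[of n i] by (intro power_mono) auto
    ultimately show "\<exists>i\<in>I. \<omega> \<in> S i \<and> (point \<omega> $ 2 - c $ 2)\<^sup>2 \<le> (row_height n i + side (Suc n))\<^sup>2"
      using i code_in_strip[OF \<omega> i(2)] by (auto simp: I_def S_def)
  qed auto
  also have "\<dots> \<le> (\<Sum>i\<in>I. (row_height n i + side (Suc n))\<^sup>2 * (3 * l * row_density n i))"
  proof (intro sum_mono mult_left_mono)
    fix i assume "i \<in> I"
    moreover have "j \<le> gap_exp n i"
      using assms(1) by (simp add: gap_exp_def)
    ultimately show "measure code_measure (S i) \<le> 3 * l * row_density n i"
      unfolding S_def by (intro measure_triple_strip_le) (auto simp: I_def)
  qed simp
  finally show ?thesis by (simp add: I_def)
qed

lemma centre_row_moment_le: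
  assumes "j \<le> side_exp n + 2 * satellites n"
  shows "(side (Suc n))\<^sup>2 * 2 ^ (b + n) \<le> (1/2) ^ (b + n) * l\<^sup>2"
proof -
  have "4 ^ (b + n) * side (Suc n) \<le> 8 * 4 ^ (b + n) * side (Suc n)"
    by (simp add: less_imp_le)
  also have "\<dots> = (1/2) ^ (side_exp n + 2 * satellites n)"
    unfolding row_height_satellites[symmetric] by (simp add: row_height_def)
  also have "\<dots> \<le> l"
    unfolding l_def using assms by (intro power_decreasing) auto
  finally have "4 ^ (b + n) * side (Suc n) * side (Suc n) \<le> l * l"
    using side_Suc_le_scale scale_pos by (intro mult_mono) (auto simp: less_imp_le)
  then have "(1/2) ^ (b + n) * (4 ^ (b + n) * side (Suc n) * side (Suc n)) \<le> (1/2) ^ (b + n) * l\<^sup>2"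
    by (intro mult_left_mono) (auto simp: power2_eq_square)
  then show ?thesis
    unfolding four_power_eq[of "b + n"] by (simp add: power_one_over power2_eq_square mult_ac)
qed

lemma second_moment_le:
  assumes scale: "j \<le> side_exp n + 2 * satellites n" and base: "a $ 2 \<le> c $ 2 + l"
  shows "(LINT y:triple Q|mu. (y $ 2 - c $ 2)\<^sup>2) \<le> 128 * (1/2) ^ (b + n) * l ^ 3"
proof -
  define I where "I = {i. 0 < i \<and> i \<le> satellites n \<and> row_height n i < 3 * l}"
  have "{i. i \<le> satellites n \<and> row_height n i < 3 * l} = insert 0 I"
    using scale_pos by (auto simp: I_def)
  then have "(LINT y:triple Q|mu. (y $ 2 - c $ 2)\<^sup>2)
      \<le> (\<Sum>i\<in>insert 0 I. (row_height n i + side (Suc n))\<^sup>2 * (3 * l * row_density n i))"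
    using second_moment_le_row_sum[OF assms] by simp
  also have "\<dots> = 3 * l * ((side (Suc n))\<^sup>2 * 2 ^ (b + n))
      + (\<Sum>i\<in>I. (row_height n i + side (Suc n))\<^sup>2 * (3 * l * row_density n i))"
    by (subst sum.insert) (auto simp: I_def row_density_def)
  also have "\<dots> \<le> 3 * l * ((1/2) ^ (b + n) * l\<^sup>2) + 12 * l * (1/2) ^ (b + n) * (16/15 * (3 * l)\<^sup>2)"
  proof (intro add_mono mult_left_mono centre_row_moment_le[OF scale])
    have "(\<Sum>i\<in>I. (row_height n i + side (Suc n))\<^sup>2 * (3 * l * row_density n i))
        \<le> (\<Sum>i\<in>I. (2 * row_height n i)\<^sup>2 * (3 * l * (1/2) ^ (b + n)))"
    proof (rule sum_mono)
      fix i assume "i \<in> I"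
      then have "8 * side (Suc n) \<le> row_height n i"
        by (intro side_Suc_le_row_height) (auto simp: I_def)
      then have "(row_height n i + side (Suc n))\<^sup>2 \<le> (2 * row_height n i)\<^sup>2"
        using side_pos[of "Suc n"] by (intro power_mono) linarith+
      then show "(row_height n i + side (Suc n))\<^sup>2 * (3 * l * row_density n i)
          \<le> (2 * row_height n i)\<^sup>2 * (3 * l * (1/2) ^ (b + n))"
        using \<open>i \<in> I\<close> scale_pos by (simp add: I_def row_density_def)
    qed
    also have "\<dots> = 12 * l * (1/2) ^ (b + n) * (\<Sum>i\<in>I. (row_height n i)\<^sup>2)"
      by (simp add: sum_distrib_left power_mult_distrib mult_ac)
    also have "\<dots> \<le> 12 * l * (1/2) ^ (b + n) * (16/15 * (3 * l)\<^sup>2)"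
      unfolding I_def using scale_pos by (intro mult_left_mono sum_row_height_sq_le) auto
    finally show "(\<Sum>i\<in>I. (row_height n i + side (Suc n))\<^sup>2 * (3 * l * row_density n i))
        \<le> 12 * l * (1/2) ^ (b + n) * (16/15 * (3 * l)\<^sup>2)" .
  qed (use scale_pos in auto)
  also have "\<dots> = (3 + 12 * (16/15) * 9) * ((1/2) ^ (b + n) * l ^ 3)"
    by (simp add: power2_eq_square power3_eq_cube algebra_simps)
  also have "\<dots> \<le> 128 * ((1/2) ^ (b + n) * l ^ 3)"
    using scale_pos by (intro mult_right_mono) auto
  finally show ?thesis by (simp add: mult.assoc)
qed

lemma jones_summand_le_of_moment:
  assumes "(LINT y:triple Q|mu. (y $ 2 - h)\<^sup>2) \<le> M * measure mu (triple Q)" "0 \<le> M"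
    and "m \<le> measure mu Q" "0 < m"
  shows "jones_summand mu Q \<le> ennreal (M / (l * m))"
  by (rule jones_summand_le[OF assms(1) square_eq scale_pos assms(2) _ assms(4)])
    (use assms(3) in \<open>simp add: mu.emeasure_eq_measure ennreal_leI\<close>)

lemma jones_summand_le_of_density:
  assumes scale: "j \<le> side_exp n + 2 * satellites n" and base: "a $ 2 \<le> c $ 2 + l"
    and density: "l * \<rho> \<le> measure mu Q" "0 < \<rho>"
  shows "jones_summand mu Q \<le> ennreal (128 * (1/4) ^ (b + n) / \<rho>)"
proof -
  have "l * row_density n 0 \<le> measure mu (triple Q)"
  proof (rule measure_ge_row[OF _ _ square_borel(2)])
    fix y :: "real^2"
    assume "a $ 1 \<le> y $ 1" "y $ 1 < a $ 1 + l" "c $ 2 + row_height n 0 \<le> y $ 2"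
      "y $ 2 < c $ 2 + row_height n 0 + side (Suc n)"
    then show "y \<in> triple Q"
      using base parent_le_base[of 2] scale_pos side_Suc_le_scale
      unfolding mem_triple_square_iff forall_2 row_height_0 by linarith
  qed (use scale in \<open>auto simp: gap_exp_def\<close>)
  then have triple: "l * 2 ^ (b + n) \<le> measure mu (triple Q)"
    by (simp add: row_density_def)
  have "(1/2::real) ^ (b + n) = (1/4) ^ (b + n) * 2 ^ (b + n)"
    by (simp flip: power_mult_distrib)
  then have "128 * (1/2) ^ (b + n) * l ^ 3 = 128 * (1/4) ^ (b + n) * l\<^sup>2 * (l * 2 ^ (b + n))"
    by (simp add: power2_eq_square power3_eq_cube)
  also have "\<dots> \<le> 128 * (1/4) ^ (b + n) * l\<^sup>2 * measure mu (triple Q)"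
    by (intro mult_left_mono triple) simp
  finally have "(LINT y:triple Q|mu. (y $ 2 - c $ 2)\<^sup>2)
      \<le> 128 * (1/4) ^ (b + n) * l\<^sup>2 * measure mu (triple Q)"
    using second_moment_le[OF scale base] by simp
  then have "jones_summand mu Q \<le> ennreal (128 * (1/4) ^ (b + n) * l\<^sup>2 / (l * (l * \<rho>)))"
    using density scale_pos by (intro jones_summand_le_of_moment) auto
  also have "128 * (1/4) ^ (b + n) * l\<^sup>2 / (l * (l * \<rho>)) = 128 * (1/4) ^ (b + n) / \<rho>"
    using scale_pos by (simp add: power2_eq_square)
  finally show ?thesis .
qed

lemma isolated_row:
  assumes i: "i \<le> satellites n" "\<xi> n \<in> row_digits n i" and isolated: "isolation_exp n i < j"
    and \<omega>: "\<omega> \<in> codes" "point \<omega> \<in> triple Q"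
  shows "\<omega> n \<in> row_digits n i"
proof -
  define d where "d = row_height n (if i = 0 then satellites n else i)"
  obtain k where k: "k \<le> satellites n" "\<omega> n \<in> row_digits n k"
    using codesD[OF \<omega>(1), of n] by (rule digitsE)
  have "(1/2::real) ^ j \<le> (1/2) ^ Suc (isolation_exp n i)"
    using isolated by (intro power_decreasing) auto
  then have "2 * l \<le> d"
    using power_isolation_exp[of n i] by (simp add: l_def d_def)
  moreover have "a $ 2 = c $ 2 + row_height n i"
    using base_2_eq[OF i(2)] isolated by (auto simp: isolation_exp_def split: if_splits)
  then have "c $ 2 + row_height n i - l \<le> point \<omega> $ 2"
    "point \<omega> $ 2 < c $ 2 + row_height n i + 2 * l"
    using \<omega>(2) by (auto simp: mem_triple_square_iff forall_2)
  ultimately have "\<not> (row_height n k + side (Suc n) \<le> row_height n i - d / 2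
      \<or> row_height n i + d \<le> row_height n k)"
    using point_in_row_bounds[OF \<omega>(1) same_prefix[OF \<omega>] k(2)] by linarith
  then have "k = i"
    using row_height_isolated[OF _ k(1) i(1) d_def] by blast
  with k show ?thesis by simp
qed

lemma jones_summand_isolated_row_le:
  assumes "i \<le> satellites n" "\<xi> n \<in> row_digits n i" "isolation_exp n i < j"
  shows "jones_summand mu Q \<le> ennreal ((1/2) ^ (b + n) * (side (Suc n) / (4 * l)))"
proof -
  have "(LINT y:triple Q|mu. (y $ 2 - (c $ 2 + row_height n i))\<^sup>2)
      \<le> (side (Suc n))\<^sup>2 * measure mu (triple Q)"
  proof (rule set_integral_mu_le[OF square_borel(2)])
    fix \<omega> assume \<omega>: "\<omega> \<in> codes" "point \<omega> \<in> triple Q"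
    then show "(point \<omega> $ 2 - (c $ 2 + row_height n i))\<^sup>2 \<le> (side (Suc n))\<^sup>2"
      using point_in_row_bounds[OF \<omega>(1) same_prefix[OF \<omega>] isolated_row[OF assms \<omega>]]
      by (intro power_mono) auto
  qed auto
  then have "jones_summand mu Q \<le> ennreal ((side (Suc n))\<^sup>2 / (l * mass (Suc n)))"
    using measure_square_ge_mass by (intro jones_summand_le_of_moment) auto
  also have "(side (Suc n))\<^sup>2 / (l * mass (Suc n)) = (1/2) ^ (b + n) * (side (Suc n) / (4 * l))"
    using scale_pos by (simp add: mass_eq power2_eq_square power_one_over power_add)
  finally show ?thesis .
qed

lemma measure_square_ge_row:
  assumes "i \<le> satellites n" "j \<le> side_exp n + 2 * satellites n" "a $ 2 = c $ 2 + row_height n i"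
  shows "l * row_density n i \<le> measure mu Q"
proof (rule measure_ge_row[OF assms(1) _ square_borel(1)])
  fix y :: "real^2"
  assume "a $ 1 \<le> y $ 1" "y $ 1 < a $ 1 + l" "c $ 2 + row_height n i \<le> y $ 2"
    "y $ 2 < c $ 2 + row_height n i + side (Suc n)"
  then show "y \<in> Q"
    using assms(3) side_Suc_le_scale unfolding mem_square_iff forall_2 by linarith
qed (use assms(2) in \<open>simp add: gap_exp_def\<close>)

lemma jones_summand_at_satellite_height_le:
  assumes i: "0 < i" "i \<le> satellites n" "\<xi> n \<in> row_digits n i" and j_eq: "j = side_exp n + 2 * i"
  shows "jones_summand mu Q \<le> ennreal ((1/2) ^ (b + n) * 128)"
proof -
  have base: "a $ 2 = c $ 2 + row_height n i" "row_height n i = l"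
    using base_2_eq[OF i(3)] i(1) j_eq by (simp_all add: row_height_def l_def)
  have scale: "j \<le> side_exp n + 2 * satellites n"
    using i j_eq by simp
  have "jones_summand mu Q \<le> ennreal (128 * (1/4) ^ (b + n) / row_density n i)"
    using measure_square_ge_row[OF i(2) scale base(1)] base i(1)
    by (intro jones_summand_le_of_density[OF scale]) (auto simp: row_density_def)
  also have "128 * (1/4) ^ (b + n) / row_density n i = (1/2) ^ (b + n) * 128"
    using i(1) by (simp add: row_density_def power_one_over four_power_eq)
  finally show ?thesis .
qed

lemma jones_summand_centre_row_le:
  assumes scale: "j \<le> side_exp n + 2 * satellites n" and base: "a $ 2 = c $ 2"
  shows "jones_summand mu Q \<le> ennreal ((1/2) ^ (b + n) * (128 * (1/4) ^ (b + n)))"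
proof -
  have "jones_summand mu Q \<le> ennreal (128 * (1/4) ^ (b + n) / row_density n 0)"
    using measure_square_ge_row[of 0] scale base scale_pos
    by (intro jones_summand_le_of_density) (auto simp: row_density_def)
  also have "128 * (1/4) ^ (b + n) / row_density n 0 = (1/2) ^ (b + n) * (128 * (1/4) ^ (b + n))"
    by (simp add: row_density_def power_one_over)
  finally show ?thesis .
qed

lemma jones_summand_dyadic_square_le:
  assumes i: "i \<le> satellites n" "\<xi> n \<in> row_digits n i"
  shows "jones_summand mu Q \<le> ennreal ((1/2) ^ (b + n) * (side (Suc n) / (4 * l)
      + 128 * of_bool (j = side_exp n + 2 * i)
      + 128 * (1/4) ^ (b + n) * of_bool (j \<le> side_exp n + 2 * satellites n)))"
    (is "_ \<le> ennreal (?q * (?isolated + ?height + ?centre))")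
proof -
  have nonneg: "0 \<le> ?isolated" "0 \<le> ?height" "0 \<le> ?centre"
    using scale_pos by simp_all
  consider "isolation_exp n i < j" | "0 < i" "j = isolation_exp n i"
    | "j \<le> isolation_exp n i" "i = 0 \<or> j < isolation_exp n i"
    by linarith
  then have "jones_summand mu Q \<le> ennreal (?q * ?isolated)
      \<or> jones_summand mu Q \<le> ennreal (?q * ?height)
      \<or> jones_summand mu Q \<le> ennreal (?q * ?centre)"
  proof cases
    case 1
    then show ?thesis
      using jones_summand_isolated_row_le[OF i] by blast
  next
    case 2
    then show ?thesis
      using jones_summand_at_satellite_height_le[OF _ i] by (simp add: isolation_exp_def)
  next
    case 3
    then have "a $ 2 = c $ 2"
      using base_2_eq[OF i(2)] by (auto simp: isolation_exp_def split: if_splits)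
    moreover have "j \<le> side_exp n + 2 * satellites n"
      using 3 isolation_exp_le[OF i(1)] by simp
    ultimately show ?thesis
      using jones_summand_centre_row_le by simp
  qed
  moreover have "ennreal (?q * t) \<le> ennreal (?q * (?isolated + ?height + ?centre))"
    if "t \<in> {?isolated, ?height, ?centre}" for t
    using that nonneg by (intro ennreal_leI mult_left_mono) auto
  ultimately show ?thesis
    by (meson insertCI order_trans)
qed

lemma measure_ball_isolated_row_le:
  assumes i: "i \<le> satellites n" "\<xi> n \<in> row_digits n i" and j_eq: "j = Suc (isolation_exp n i)"
  shows "measure mu (ball (point \<xi>) l) \<le> 3 * l * row_density n i"
proof -
  have "j \<le> gap_exp n i"
    using isolation_exp_less_gap_exp[OF i(1)] j_eq by simp
  have "ball (point \<xi>) l \<subseteq> triple Q"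
  proof
    fix y assume "y \<in> ball (point \<xi>) l"
    have "a $ k - l \<le> y $ k \<and> y $ k < a $ k + 2 * l" for k
    proof -
      have "\<bar>point \<xi> $ k - y $ k\<bar> < l"
        using \<open>y \<in> ball (point \<xi>) l\<close> dist_vec_nth_le[of "point \<xi>" k y] by (simp add: dist_real_def)
      moreover have "a $ k \<le> point \<xi> $ k" "point \<xi> $ k < a $ k + l"
        using point_mem_square by (auto simp: mem_square_iff)
      ultimately show ?thesis by linarith
    qed
    then show "y \<in> triple Q"
      by (simp add: mem_triple_square_iff)
  qed
  then have "{\<omega> \<in> codes. point \<omega> \<in> ball (point \<xi>) l} \<subseteq> strip \<xi> n i (a $ 1 - l) (a $ 1 + 2 * l)"
    using code_in_strip isolated_row[OF i] j_eq by auto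
  then have "measure mu (ball (point \<xi>) l)
      \<le> measure code_measure (strip \<xi> n i (a $ 1 - l) (a $ 1 + 2 * l))"
    by (subst measure_mu) (auto intro!: codes.finite_measure_mono sets_strip \<xi> i)
  also have "\<dots> \<le> 3 * l * row_density n i"
    by (rule measure_triple_strip_le[OF i(1) \<open>j \<le> gap_exp n i\<close>])
  finally show ?thesis .
qed

end

section \<open>Summation over the scales\<close>

lemma sum_isolated_scales_le:
  "(\<Sum>j\<in>{side_exp n<..side_exp (Suc n)}. side (Suc n) / (4 * (1/2) ^ j)) \<le> 1"
proof -
  define e where "e = side_exp (Suc n)"
  have "(\<Sum>j\<in>{side_exp n<..e}. side (Suc n) / (4 * (1/2) ^ j))
      = (\<Sum>j\<in>{side_exp n<..e}. 1/4 * (1/2) ^ (e - j))"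
    by (intro sum.cong) (auto simp: side_def e_def power_diff)
  also have "\<dots> = (\<Sum>i\<in>(\<lambda>j. e - j) ` {side_exp n<..e}. 1/4 * (1/2) ^ i)"
    by (subst sum.reindex) (auto simp: inj_on_def)
  also have "\<dots> \<le> (1/4) / (1 - 1/2)"
    by (rule sum_geometric_subset_le) (auto simp: power_le_one)
  finally show ?thesis by (simp add: e_def)
qed

lemma jones_generation_sum_le:
  assumes "\<omega> \<in> codes"
  shows "(\<Sum>j\<in>{side_exp n<..side_exp (Suc n)}. jones_summand mu (dyadic_square_at j (point \<omega>)))
    \<le> ennreal (385 * (1/2) ^ (b + n))"
proof -
  obtain i where i: "i \<le> satellites n" "\<omega> n \<in> row_digits n i"
    using codesD[OF assms, of n] by (rule digitsE)
  define J where "J = {side_exp n<..side_exp (Suc n)}"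
  define isolated :: "nat \<Rightarrow> real"
    where "isolated j = side (Suc n) / (4 * (1/2) ^ j)" for j
  define at_height :: "nat \<Rightarrow> real"
    where "at_height j = 128 * of_bool (j = side_exp n + 2 * i)" for j
  define centre :: "nat \<Rightarrow> real"
    where "centre j = 128 * (1/4) ^ (b + n) * of_bool (j \<le> side_exp n + 2 * satellites n)" for j
  have "(\<Sum>j\<in>J. jones_summand mu (dyadic_square_at j (point \<omega>)))
      \<le> (\<Sum>j\<in>J. ennreal ((1/2) ^ (b + n) * (isolated j + at_height j + centre j)))"
    unfolding isolated_def at_height_def centre_def
    by (intro sum_mono jones_summand_dyadic_square_le assms i) (auto simp: J_def)
  also have "\<dots> = ennreal (\<Sum>j\<in>J. (1/2) ^ (b + n) * (isolated j + at_height j + centre j))"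
    by (intro sum_ennreal) (simp add: isolated_def at_height_def centre_def)
  also have "\<dots> = ennreal ((1/2) ^ (b + n) * (sum isolated J + sum at_height J + sum centre J))"
    by (simp only: sum_distrib_left[symmetric] sum.distrib)
  also have "\<dots> \<le> ennreal ((1/2) ^ (b + n) * (1 + 128 + 256))"
  proof (intro ennreal_leI mult_left_mono add_mono)
    show "sum isolated J \<le> 1"
      unfolding isolated_def J_def by (rule sum_isolated_scales_le)
    have "sum at_height J = 128 * of_bool (side_exp n + 2 * i \<in> J)"
      by (simp add: at_height_def J_def of_bool_def flip: sum_distrib_left)
    then show "sum at_height J \<le> 128"
      by simp
    have "sum centre J = (\<Sum>j\<in>J \<inter> {..side_exp n + 2 * satellites n}. 128 * (1/4) ^ (b + n))"
      by (rule sum.mono_neutral_cong_right) (auto simp: J_def centre_def)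
    also have "\<dots> \<le> (\<Sum>j\<in>{side_exp n<..side_exp n + 2 * satellites n}. 128 * (1/4) ^ (b + n))"
      by (intro sum_mono2) (auto simp: J_def)
    also have "\<dots> = 256"
      by (simp add: satellites_def power_one_over)
    finally show "sum centre J \<le> 256" .
  qed simp
  finally show ?thesis by (simp add: J_def mult.commute)
qed

lemma jones_summand_initial_le:
  assumes "\<omega> \<in> codes" "j \<le> b + 1"
  shows "jones_summand mu (dyadic_square_at j (point \<omega>)) \<le> ennreal ((1/4) ^ (b + 1) * 2 ^ j)"
proof -
  define Q where "Q = dyadic_square_at j (point \<omega>)"
  have bounds: "0 \<le> point \<eta> $ k" "point \<eta> $ k < side 0" if "\<eta> \<in> codes" for \<eta> k
    using corner_le_point[OF that, of 0 k] point_less_corner_add[OF that, of k 0] by simp_all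
  have "side 0 \<le> (1/2) ^ j"
    unfolding side_def using assms(2) by (intro power_decreasing) auto
  then have "dyadic_floor j (point \<eta> $ k) = 0" if "\<eta> \<in> codes" for \<eta> k
    using bounds[OF that, of k] by (intro dyadic_floor_eqI) auto
  then have "{\<eta> \<in> codes. point \<eta> \<in> Q} = codes"
    using assms(1) by (auto simp: Q_def mem_dyadic_square_at_iff)
  then have "measure mu Q = 1"
    using codes.prob_space by (simp add: Q_def measure_mu)
  have moment: "(LINT y:triple Q|mu. (y $ 2 - 0)\<^sup>2) \<le> (side 0)\<^sup>2 * measure mu (triple Q)"
    using bounds by (intro set_integral_mu_le) (auto simp: Q_def intro!: power_mono less_imp_le)
  have "jones_summand mu Q \<le> ennreal ((side 0)\<^sup>2 / ((1/2) ^ j * 1))"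
    by (rule jones_summand_le[OF moment Q_def[unfolded dyadic_square_at_def]])
      (use \<open>measure mu Q = 1\<close> in \<open>simp_all add: mu.emeasure_eq_measure\<close>)
  also have "(side 0)\<^sup>2 / ((1/2) ^ j * 1) = (1/4) ^ (b + 1) * 2 ^ j"
    by (simp add: side_def power_one_over power2_eq_square four_power_eq)
  finally show ?thesis by (simp add: Q_def)
qed

lemma jones_sum_le:
  assumes "\<omega> \<in> codes"
  shows "(\<Sum>j\<le>side_exp n. jones_summand mu (dyadic_square_at j (point \<omega>)))
    \<le> ennreal ((1/2) ^ b + (\<Sum>m<n. 385 * (1/2) ^ (b + m)))"
proof (induction n)
  case 0
  have geometric: "(\<Sum>j\<le>b + 1. (2::real) ^ j) \<le> 2 ^ (b + 2)"
    using geometric_sum[of "2::real" "Suc (b + 1)"] by (simp add: lessThan_Suc_atMost)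
  have "(\<Sum>j\<le>b + 1. jones_summand mu (dyadic_square_at j (point \<omega>)))
      \<le> (\<Sum>j\<le>b + 1. ennreal ((1/4) ^ (b + 1) * 2 ^ j))"
    by (intro sum_mono jones_summand_initial_le assms) simp
  also have "\<dots> = ennreal (\<Sum>j\<le>b + 1. (1/4) ^ (b + 1) * 2 ^ j)"
    by (rule sum_ennreal) simp
  also have "\<dots> \<le> ennreal ((1/4) ^ (b + 1) * 2 ^ (b + 2))"
    unfolding sum_distrib_left[symmetric] by (intro ennreal_leI mult_left_mono geometric) simp
  also have "\<dots> = ennreal ((1/2) ^ b)"
    by (simp add: power_one_over four_power_eq)
  finally show ?case by simp
next
  case (Suc n)
  define f where "f j = jones_summand mu (dyadic_square_at j (point \<omega>))" for j
  have "sum f {..side_exp (Suc n)} = sum f {..side_exp n} + sum f {side_exp n<..side_exp (Suc n)}"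
    using side_exp_mono[of n "Suc n"]
    by (subst sum.union_disjoint[symmetric]) (auto intro: sum.cong simp: ivl_disj_un)
  also have "\<dots> \<le> ennreal ((1/2) ^ b + (\<Sum>m<n. 385 * (1/2) ^ (b + m)))
      + ennreal (385 * (1/2) ^ (b + n))"
    unfolding f_def by (intro add_mono Suc.IH jones_generation_sum_le assms)
  also have "\<dots> = ennreal ((1/2) ^ b + (\<Sum>m<Suc n. 385 * (1/2) ^ (b + m)))"
    by (subst ennreal_plus[symmetric]) (auto intro!: add_nonneg_nonneg sum_nonneg simp: add.assoc)
  finally show ?case by (simp add: f_def)
qed

lemma jones1_spt_le:
  assumes "x \<in> spt mu"
  shows "jones1 mu x \<le> ennreal (771 * (1/2) ^ b)"
  unfolding jones1_eq_suminf
proof (rule suminf_le_const[OF summableI])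
  from assms obtain \<omega> where \<omega>: "\<omega> \<in> codes" "x = point \<omega>"
    using spt_mu_subset by blast
  fix J
  have "(\<Sum>j<J. jones_summand mu (dyadic_square_at j x))
      \<le> (\<Sum>j\<le>side_exp J. jones_summand mu (dyadic_square_at j x))"
    using le_side_exp[of J] by (intro sum_mono2) auto
  also have "\<dots> \<le> ennreal ((1/2) ^ b + (\<Sum>m<J. 385 * (1/2) ^ (b + m)))"
    unfolding \<omega>(2) by (rule jones_sum_le[OF \<omega>(1)])
  also have "\<dots> \<le> ennreal (771 * (1/2) ^ b)"
  proof (rule ennreal_leI)
    have "(\<Sum>m<J. 385 * (1/2) ^ b * (1/2) ^ m) \<le> 385 * (1/2) ^ b / (1 - 1/2 :: real)"
      by (rule sum_geometric_subset_le) (auto simp: power_le_one)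
    then show "(1/2) ^ b + (\<Sum>m<J. 385 * (1/2) ^ (b + m)) \<le> 771 * (1/2 :: real) ^ b"
      by (simp add: power_add mult.assoc)
  qed
  finally show "(\<Sum>j<J. jones_summand mu (dyadic_square_at j x))
      \<le> ennreal (771 * (1/2) ^ b)" .
qed

section \<open>Vanishing of the lower density\<close>

lemma measure_small_ball_le:
  assumes "\<omega> \<in> codes" "\<omega> n \<notin> row_digits n 0"
  shows "\<exists>r>0. r \<le> (1/2) ^ n \<and> measure mu (ball (point \<omega>) r) \<le> 3 * (1/2) ^ n * r"
proof -
  obtain i where i: "i \<le> satellites n" "\<omega> n \<in> row_digits n i"
    using codesD[OF assms(1), of n] by (rule digitsE)
  then have "i \<noteq> 0"
    using assms(2) by metis
  define j where "j = Suc (isolation_exp n i)"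
  have j: "side_exp n < j" "j \<le> side_exp (Suc n)"
    using i(1) \<open>i \<noteq> 0\<close> by (simp_all add: j_def isolation_exp_def side_exp.simps(2))
  have "measure mu (ball (point \<omega>) ((1/2) ^ j)) \<le> 3 * (1/2) ^ j * (1/2) ^ (b + n)"
    using measure_ball_isolated_row_le[OF assms(1) j i j_def] \<open>i \<noteq> 0\<close> by (simp add: row_density_def)
  also have "\<dots> \<le> 3 * (1/2) ^ j * (1/2) ^ n"
    by (intro mult_left_mono power_decreasing) auto
  finally have "measure mu (ball (point \<omega>) ((1/2) ^ j)) \<le> 3 * (1/2) ^ n * (1/2) ^ j"
    by (simp add: mult_ac)
  moreover have "(1/2) ^ j \<le> (1/2 :: real) ^ n"
    using le_side_exp[of n] j(1) by (intro power_decreasing) auto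
  ultimately show ?thesis by (intro exI[of _ "(1/2) ^ j"]) auto
qed

definition satellite_points :: "nat \<Rightarrow> (real^2) set" where
  "satellite_points n = point ` {\<omega> \<in> codes. \<omega> n \<notin> row_digits n 0}"

lemma satellite_points_borel [measurable]: "satellite_points n \<in> sets borel"
proof -
  define D where "D = digits(n := digits n - row_digits n 0)"
  have "{\<omega> \<in> codes. \<omega> n \<notin> row_digits n 0} = PiE UNIV D"
    by (auto simp: codes_def D_def PiE_iff split: if_splits)
  moreover have "compact (point ` PiE UNIV D)"
    by (rule compact_point_image) (auto simp: D_def)
  ultimately show ?thesis
    by (simp add: satellite_points_def borel_compact)
qed

lemma vanishing_lower_density_satellite_points:
  assumes "\<exists>\<^sub>\<infinity>n. x \<in> satellite_points n"
  shows "vanishing_lower_density mu x"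
  unfolding vanishing_lower_density_def
proof (intro allI impI)
  fix \<delta> d :: real assume "0 < \<delta>" "0 < d"
  then obtain N where N: "(1/2) ^ N < min \<delta> (d / 3)"
    using real_arch_pow_inv[of "min \<delta> (d / 3)" "1/2"] by auto
  obtain n where "n > N" "x \<in> satellite_points n"
    using assms by (auto simp: INFM_nat)
  then obtain r where r: "0 < r" "r \<le> (1/2) ^ n" "measure mu (ball x r) \<le> 3 * (1/2) ^ n * r"
    using measure_small_ball_le by (auto simp: satellite_points_def)
  have "(1/2::real) ^ n \<le> (1/2) ^ N"
    using \<open>n > N\<close> by (intro power_decreasing) auto
  then have small: "(1/2) ^ n < \<delta>" "3 * (1/2) ^ n \<le> d"
    using N by linarith+
  have "measure mu (ball x r) \<le> d * r"
    using r(3) mult_right_mono[OF small(2), of r] r(1) by linarith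
  then have "emeasure mu (ball x r) \<le> ennreal (d * r)"
    by (simp add: mu.emeasure_eq_measure ennreal_leI)
  then show "\<exists>r>0. r < \<delta> \<and> emeasure mu (ball x r) \<le> ennreal (d * r)"
    using r small by (intro exI[of _ r]) auto
qed

lemma AE_satellite_points: "AE x in mu. \<exists>\<^sub>\<infinity>n. x \<in> satellite_points n"
proof -
  have "AE \<omega> in code_measure. \<exists>\<^sub>\<infinity>n. \<omega> n \<notin> row_digits n 0"
    by (rule AE_infinitely_often_digit_not_in[where q = "1/2"])
      (auto simp: row_digits_subset card_row_digits card_digits)
  then have "AE \<omega> in code_measure. \<exists>\<^sub>\<infinity>n. point \<omega> \<in> satellite_points n"
    using AE_space
  proof eventually_elim
    case (elim \<omega>)
    from elim(1) show ?case
      by (rule INFM_mono) (use elim(2) in \<open>auto simp: satellite_points_def\<close>)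
  qed
  moreover have "{x \<in> space borel. \<exists>\<^sub>\<infinity>n. x \<in> satellite_points n} \<in> sets borel"
    unfolding INFM_nat_le by measurable
  ultimately show ?thesis
    unfolding mu_def by (subst AE_distr_iff) auto
qed

lemma AE_lower_density1_eq_0: "AE x in mu. lower_density1 mu x = 0"
  using AE_satellite_points
  by eventually_elim (simp add: lower_density1_eq_0_iff vanishing_lower_density_satellite_points)

lemma spt_mu_subset_unit_square: "spt mu \<subseteq> cbox 0 1"
proof -
  have "side 0 \<le> 1"
    unfolding side_def by (rule power_le_one) auto
  then have "cbox 0 (\<chi> k. side 0) \<subseteq> cbox (0 :: real^2) 1"
    using order_trans by (fastforce simp: mem_box_cart)
  then show ?thesis
    using spt_mu_subset point_in_cbox by blast
qed

end

theorem theorem1p2: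
  fixes \<epsilon> :: real
  assumes "\<epsilon> > 0"
  shows "\<exists>\<mu> :: (real^2) measure.
           radon_measure \<mu> \<and> prob_space \<mu> \<and> spt \<mu> \<subseteq> cbox 0 1 \<and>
           (\<forall>x\<in>spt \<mu>. jones1 \<mu> x \<le> ennreal \<epsilon>) \<and>
           (AE x in \<mu>. lower_density1 \<mu> x = 0) \<and>
           purely_1_unrectifiable \<mu>"
proof -
  obtain b where b: "(1/2) ^ b < \<epsilon> / 771"
    using real_arch_pow_inv[of "\<epsilon> / 771" "1/2"] assms by auto
  interpret satellite_cantor b .
  have "ennreal (771 * (1/2) ^ b) \<le> ennreal \<epsilon>"
    using b by (intro ennreal_leI) simp
  then have "jones1 mu x \<le> ennreal \<epsilon>" if "x \<in> spt mu" for x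
    using order_trans[OF jones1_spt_le[OF that]] by blast
  moreover have "radon_measure mu"
    by (rule radon_measure_finite_borel[OF sets_mu mu.finite_measure_axioms])
  moreover have "purely_1_unrectifiable mu"
    by (rule purely_1_unrectifiableI[OF sets_mu AE_lower_density1_eq_0])
  ultimately show ?thesis
    using mu.prob_space_axioms spt_mu_subset_unit_square AE_lower_density1_eq_0 by blast
qed

end
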